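(* Let $S$ be an ordered semigroup satisfying axioms O1–O6. Let $(f_i)_{i=1}^n$ and $(g_j)_{j=1}^m$ be elements of $S_{\mathbb{R}}$ such that $$\sum_{i=1}^n f_i\leq \sum_{j=1}^m g_j.$$ Let $(f_i')_{i=1}^n$ be elements of $S_{\mathbb{R}}$ such that $f_i'\ll f_i$ in $S_{\mathbb{R}}$ for all $i$. Then there exist elements $h_{i,j}\in S_{\mathbb{R}}$, with $i=1,\dots,n$ and $j=1,\dots,m$, such that $$f_i'\ll \sum_{j=1}^m h_{i,j}\ll f_i\ \text{ for all } i,\qquad \sum_{i=1}^n h_{i,j}\leq g_j\ \text{ for all } j,$$ where $\ll$ is taken in $S_{\mathbb{R}}$.
   Context: An ordered semigroup is an abelian monoid with a translation invariant order relation in which $0$ is the smallest element. For $s,t$ in an ordered set, $s\ll t$ means: for every increasing sequence $(t_n)$ (having a supremum) with $t\leq \sup_n t_n$ there is $n_0$ with $s\leq t_{n_0}$. Axioms on an ordered semigroup $S$: O1: every increasing sequence has a supremum. O2: every $s\in S$ is the supremum of a sequence $(s_n)$ with $s_n\ll s_{n+1}$ for all $n$. O3: if $s_i\ll t_i$ for $i=1,2$ then $s_1+s_2\ll t_1+t_2$. O4: if $(s_n),(t_n)$ are increasing then $\sup_n(s_n+t_n)=\sup_n s_n+\sup_n t_n$. O5: if $s'\ll s\leq t$ then there exists $r$ with $s'+r\leq t\leq s+r$. O6: if $s\leq r+t$ then for every $s'\ll s$ there exist $r',t'$ with $s'\leq r'+t'$, $r'\leq r$, $r'\leq s$, $t'\leq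 t$, $t'\leq s$. A functional on $S$ is a map $\lambda\colon S\to[0,\infty]$ that is additive, order preserving, sends $0$ to $0$, and preserves suprema of increasing sequences. $\mathrm{F}(S)$ is the cone of all functionals (pointwise operations), with the topology in which a net $(\lambda_i)$ converges to $\lambda$ iff $\limsup_i\lambda_i(s')\leq\lambda(s)\leq\liminf_i\lambda_i(s)$ for all $s',s\in S$ with $s'\ll s$. $\mathrm{Lsc}(\mathrm{F}(S))$ is the set of lower semicontinuous functions $f\colon\mathrm{F}(S)\to[0,\infty]$ that are linear (additive, homogeneous for positive real scalars, $f(0)=0$), with pointwise order and operations. For $s\in S$, $\hat s\in\mathrm{Lsc}(\mathrm{F}(S))$ is $\hat s(\lambda)=\lambda(s)$. $S_{\mathbb{R}}\subseteq \mathrm{Lsc}(\mathrm{F}(S))$ is the ordered semigroup of functions $f$ for which there are $s_i\in S$ and positive integers $n_i$ ($i=1,2,\dots$) such that $(\hat s_i/n_i)_i$ is increasing and $f(\lambda)=\sup_i \hat s_i(\lambda)/n_i$ for all $\lambda\in\mathrm{F}(S)$. *)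

theory Defs
  imports
    "HOL-Analysis.Analysis"
    "HOL-Library.Lub_Glb"
    "HOL-Library.Function_Algebras"
begin

section \<open>Ordered semigroups and the axioms O1--O6\<close>

class ordered_semigroup = ordered_comm_monoid_add +
  assumes zero_least: "0 \<le> x"

text \<open>
  The relation \<open>s \<lless> t\<close> in the ordered set \<open>A\<close>, with the order inherited from the type; the
  sequences and their suprema are taken inside \<open>A\<close>.
\<close>

definition way_below :: "'a::order set \<Rightarrow> 'a \<Rightarrow> 'a \<Rightarrow> bool" where
  "way_below A s t \<longleftrightarrow> s \<in> A \<and> t \<in> A \<and>
     (\<forall>T u. incseq T \<and> range T \<subseteq> A \<and> isLub A (range T) u \<and> t \<le> u \<longrightarrow> (\<exists>n. s \<le> T n))"

definition axiom_O1 :: "'a::ordered_semigroup itself \<Rightarrow> bool" where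
  "axiom_O1 _ \<longleftrightarrow> (\<forall>T :: nat \<Rightarrow> 'a. incseq T \<longrightarrow> (\<exists>u. isLub UNIV (range T) u))"

definition axiom_O2 :: "'a::ordered_semigroup itself \<Rightarrow> bool" where
  "axiom_O2 _ \<longleftrightarrow>
     (\<forall>s :: 'a. \<exists>T. (\<forall>n. way_below UNIV (T n) (T (Suc n))) \<and> isLub UNIV (range T) s)"

definition axiom_O3 :: "'a::ordered_semigroup itself \<Rightarrow> bool" where
  "axiom_O3 _ \<longleftrightarrow>
     (\<forall>s\<^sub>1 s\<^sub>2 t\<^sub>1 t\<^sub>2 :: 'a. way_below UNIV s\<^sub>1 t\<^sub>1 \<and> way_below UNIV s\<^sub>2 t\<^sub>2 \<longrightarrow>
        way_below UNIV (s\<^sub>1 + s\<^sub>2) (t\<^sub>1 + t\<^sub>2))"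

definition axiom_O4 :: "'a::ordered_semigroup itself \<Rightarrow> bool" where
  "axiom_O4 _ \<longleftrightarrow>
     (\<forall>(S :: nat \<Rightarrow> 'a) T u v. incseq S \<and> incseq T \<and> isLub UNIV (range S) u \<and> isLub UNIV (range T) v
        \<longrightarrow> isLub UNIV (range (\<lambda>n. S n + T n)) (u + v))"

definition axiom_O5 :: "'a::ordered_semigroup itself \<Rightarrow> bool" where
  "axiom_O5 _ \<longleftrightarrow>
     (\<forall>s' s t :: 'a. way_below UNIV s' s \<and> s \<le> t \<longrightarrow> (\<exists>r. s' + r \<le> t \<and> t \<le> s + r))"

definition axiom_O6 :: "'a::ordered_semigroup itself \<Rightarrow> bool" where
  "axiom_O6 _ \<longleftrightarrow>
     (\<forall>s r t :: 'a. s \<le> r + t \<longrightarrow>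
        (\<forall>s'. way_below UNIV s' s \<longrightarrow>
           (\<exists>r' t'. s' \<le> r' + t' \<and> r' \<le> r \<and> r' \<le> s \<and> t' \<le> t \<and> t' \<le> s)))"

section \<open>The cone of functionals\<close>

definition is_functional :: "('a::ordered_semigroup \<Rightarrow> ennreal) \<Rightarrow> bool" where
  "is_functional \<phi> \<longleftrightarrow>
     (\<forall>s t. \<phi> (s + t) = \<phi> s + \<phi> t) \<and> mono \<phi> \<and> \<phi> 0 = 0 \<and>
     (\<forall>T u. incseq T \<and> isLub UNIV (range T) u \<longrightarrow> \<phi> u = (SUP n. \<phi> (T n)))"

typedef (overloaded) ('a::ordered_semigroup) functional =
  "{\<phi> :: 'a \<Rightarrow> ennreal. is_functional \<phi>}"
  morphisms ev Functional
  by (rule exI[of _ "\<lambda>_. 0"]) (simp add: is_functional_def mono_def)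

setup_lifting type_definition_functional

instantiation functional :: (ordered_semigroup) "{zero, plus}"
begin

lift_definition zero_functional :: "'a functional" is "\<lambda>_. 0"
  by (simp add: is_functional_def mono_def)

lift_definition plus_functional :: "'a functional \<Rightarrow> 'a functional \<Rightarrow> 'a functional"
  is "\<lambda>\<phi> \<psi> s. \<phi> s + \<psi> s"
  unfolding is_functional_def
  by (auto simp: mono_def add_ac intro!: add_mono ennreal_SUP_add[symmetric] monoI
      dest: monoD incseqD)

instance ..

end

lift_definition scale_functional ::
  "real \<Rightarrow> 'a::ordered_semigroup functional \<Rightarrow> 'a functional"
  is "\<lambda>r \<phi> s. ennreal r * \<phi> s"
  by (auto simp: is_functional_def mono_def distrib_left SUP_mult_left_ennreal mult_left_mono)

text \<open>
  Convergence is formulated for filters; for a net it is applied to the image under the net of the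
  filter of tails of its index set.
\<close>

definition functional_converges ::
  "'a::ordered_semigroup functional filter \<Rightarrow> 'a functional \<Rightarrow> bool" where
  "functional_converges F \<phi> \<longleftrightarrow>
     (\<forall>s' s. way_below UNIV s' s \<longrightarrow>
        Limsup F (\<lambda>\<psi>. ev \<psi> s') \<le> ev \<phi> s \<and> ev \<phi> s \<le> Liminf F (\<lambda>\<psi>. ev \<psi> s))"

text \<open>
  The only topology that can have the above as its convergence relation; that it does so under O2
  is lemma \<open>le_nhds_functional_iff\<close> below.
\<close>

instantiation functional :: (ordered_semigroup) topological_space
begin

definition open_functional :: "'a functional set \<Rightarrow> bool" where
  "open_functional U \<longleftrightarrow>
     (\<forall>\<phi>\<in>U. \<forall>F. functional_converges F \<phi> \<longrightarrow> eventually (\<lambda>\<psi>. \<psi> \<in> U) F)"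

instance
proof
  show "open (UNIV :: 'a functional set)"
    by (simp add: open_functional_def)
next
  fix U V :: "'a functional set"
  assume "open U" "open V"
  then show "open (U \<inter> V)"
    unfolding open_functional_def by (auto intro: eventually_conj)
next
  fix K :: "'a functional set set"
  assume K: "\<forall>U\<in>K. open U"
  show "open (\<Union>K)"
    unfolding open_functional_def
  proof (intro ballI allI impI)
    fix \<phi> F
    assume "\<phi> \<in> \<Union>K" and F: "functional_converges F \<phi>"
    then obtain U where U: "U \<in> K" "\<phi> \<in> U" by blast
    with K F have "eventually (\<lambda>\<psi>. \<psi> \<in> U) F"
      by (simp add: open_functional_def)
    then show "eventually (\<lambda>\<psi>. \<psi> \<in> \<Union>K) F"
      by eventually_elim (use U in blast)
  qed
qed

end

lemma way_below_zero: "way_below UNIV (0::'a::ordered_semigroup) s"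
  by (simp add: way_below_def zero_least)

lemma way_below_mono:
  fixes s t :: "'a::order"
  assumes "s' \<le> s" "way_below UNIV s t" "t \<le> t'"
  shows "way_below UNIV s' t'"
  using assms unfolding way_below_def by (meson UNIV_I order_trans)

lemma way_below_imp_le:
  fixes s t :: "'a::order"
  assumes "way_below UNIV s t"
  shows "s \<le> t"
proof -
  have "isLub UNIV (range (\<lambda>_::nat. t)) t"
    by (auto simp: isLub_def leastP_def isUb_def setle_def setge_def)
  with assms show ?thesis
    unfolding way_below_def by (metis incseq_const order_refl rangeE subset_UNIV)
qed

lemma way_below_interpolate:
  fixes s' s :: "'a::ordered_semigroup"
  assumes O2: "axiom_O2 TYPE('a)" and s: "way_below UNIV s' s"
  obtains t where "way_below UNIV s' t" "way_below UNIV t s"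
proof -
  obtain T where T: "\<And>n. way_below UNIV (T n) (T (Suc n))" and lub: "isLub UNIV (range T) s"
    using O2 unfolding axiom_O2_def by blast
  have le: "T n \<le> s" for n
    using lub by (meson isLubD2 rangeI)
  have "incseq T"
    using T by (intro incseq_SucI way_below_imp_le)
  then obtain n where "s' \<le> T n"
    using s lub unfolding way_below_def by blast
  then have "way_below UNIV s' (T (Suc n))"
    using way_below_mono[OF _ T] by blast
  moreover have "way_below UNIV (T (Suc n)) s"
    using way_below_mono[OF order_refl T le] .
  ultimately show ?thesis by (rule that)
qed

lemma open_ev_greater: "open {\<phi> :: 'a::ordered_semigroup functional. c < ev \<phi> s}"
  unfolding open_functional_def
proof (intro ballI allI impI)
  fix \<phi> :: "'a functional" and F
  assume "\<phi> \<in> {\<phi>. c < ev \<phi> s}" and "functional_converges F \<phi>"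
  then have "c < Liminf F (\<lambda>\<psi>. ev \<psi> s)"
    unfolding functional_converges_def using way_below_zero[of s] by (force intro: less_le_trans)
  then show "eventually (\<lambda>\<psi>. \<psi> \<in> {\<phi>. c < ev \<phi> s}) F"
    by (auto dest: less_LiminfD)
qed

lemma le_nhds_functional_iff:
  fixes \<phi> :: "'a::ordered_semigroup functional"
  assumes O2: "axiom_O2 TYPE('a)"
  shows "F \<le> nhds \<phi> \<longleftrightarrow> functional_converges F \<phi>"
proof
  assume "functional_converges F \<phi>"
  then show "F \<le> nhds \<phi>"
    unfolding le_filter_def eventually_nhds open_functional_def by (blast intro: eventually_mono)
next
  assume F: "F \<le> nhds \<phi>"
  have in_open: "eventually (\<lambda>\<psi>. \<psi> \<in> U) F" if "open U" "\<phi> \<in> U" for U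
    using F that by (auto simp: le_filter_def eventually_nhds)
  show "functional_converges F \<phi>"
    unfolding functional_converges_def
  proof (intro allI impI conjI)
    fix s' s :: 'a
    assume s: "way_below UNIV s' s"
    show "ev \<phi> s \<le> Liminf F (\<lambda>\<psi>. ev \<psi> s)"
      unfolding le_Liminf_iff
    proof (intro allI impI)
      fix c assume "c < ev \<phi> s"
      then show "eventually (\<lambda>\<psi>. c < ev \<psi> s) F"
        using in_open[OF open_ev_greater[of c s]] by simp
    qed
    show "Limsup F (\<lambda>\<psi>. ev \<psi> s') \<le> ev \<phi> s"
      unfolding Limsup_le_iff
    proof (intro allI impI)
      fix c assume c: "ev \<phi> s < c"
      define W where "W = {\<psi>. \<exists>t. way_below UNIV s' t \<and> ev \<psi> t < c}"
      have "open W"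
        unfolding open_functional_def
      proof (intro ballI allI impI)
        fix \<psi> :: "'a functional" and G
        assume "\<psi> \<in> W" and G: "functional_converges G \<psi>"
        then obtain t where t: "way_below UNIV s' t" "ev \<psi> t < c"
          by (auto simp: W_def)
        obtain t' where t': "way_below UNIV s' t'" "way_below UNIV t' t"
          using way_below_interpolate[OF O2 t(1)] .
        have "Limsup G (\<lambda>\<psi>. ev \<psi> t') < c"
          using G t(2) t'(2) unfolding functional_converges_def by (meson le_less_trans)
        then have "eventually (\<lambda>\<psi>. ev \<psi> t' < c) G"
          by (rule Limsup_lessD)
        then show "eventually (\<lambda>\<psi>. \<psi> \<in> W) G"
          by eventually_elim (use t'(1) in \<open>auto simp: W_def\<close>)
      qed
      moreover have "\<phi> \<in> W"
        using s c by (auto simp: W_def)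
      ultimately have "eventually (\<lambda>\<psi>. \<psi> \<in> W) F"
        by (rule in_open)
      then show "eventually (\<lambda>\<psi>. ev \<psi> s' < c) F"
      proof eventually_elim
        fix \<psi> assume "\<psi> \<in> W"
        then obtain t where t: "way_below UNIV s' t" "ev \<psi> t < c"
          by (auto simp: W_def)
        then have "s' \<le> t"
          by (blast intro: way_below_imp_le)
        moreover have "mono (ev \<psi>)"
          using functional.ev[of \<psi>] by (simp add: is_functional_def)
        ultimately show "ev \<psi> s' < c"
          using t(2) by (meson le_less_trans monoD)
      qed
    qed
  qed
qed

section \<open>Lower semicontinuous linear functions on the cone, and \<open>S_R\<close>\<close>

text \<open>Sums and the order of functions are the pointwise ones of the library.\<close>

definition Lsc :: "('a::ordered_semigroup functional \<Rightarrow> ennreal) set" where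
  "Lsc = {f. (\<forall>c. open {\<phi>. c < f \<phi>}) \<and>
             (\<forall>\<phi> \<psi>. f (\<phi> + \<psi>) = f \<phi> + f \<psi>) \<and>
             (\<forall>r>0. \<forall>\<phi>. f (scale_functional r \<phi>) = ennreal r * f \<phi>) \<and>
             f 0 = 0}"

definition hat :: "'a::ordered_semigroup \<Rightarrow> 'a functional \<Rightarrow> ennreal" where
  "hat s \<phi> = ev \<phi> s"

lemma hat_in_Lsc: "hat s \<in> Lsc"
  by (simp add: Lsc_def hat_def open_ev_greater zero_functional.rep_eq plus_functional.rep_eq
      scale_functional.rep_eq)

definition S_R :: "('a::ordered_semigroup functional \<Rightarrow> ennreal) set" where
  "S_R = {f \<in> Lsc. \<exists>(s :: nat \<Rightarrow> 'a) k :: nat \<Rightarrow> nat.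
             (\<forall>i. 0 < k i) \<and>
             incseq (\<lambda>i \<phi>. hat (s i) \<phi> / of_nat (k i)) \<and>
             (\<forall>\<phi>. f \<phi> = (SUP i. hat (s i) \<phi> / of_nat (k i)))}"

end

theory Submission
  imports Defs "HOL-Real_Asymp.Real_Asymp"
begin

text \<open>
  Hahn--Banach in ordered semigroups turns inequalities between functions \<open>hat s\<close> into inequalities
  between multiples in \<open>S\<close>, so that O5 and O6 can be used, up to small errors, for the functions
  \<open>hat s / k\<close> and hence for \<open>S_R\<close>.

  By O6 there are \<open>a\<^sub>i\<^sub>j\<close> below \<open>f\<^sub>i\<close> and \<open>2 g\<^sub>j\<close> with \<open>f'\<^sub>i \<le> \<Sum>\<^sub>j a\<^sub>i\<^sub>j\<close>, so \<open>h\<^sub>i\<^sub>j = a\<^sub>i\<^sub>j / D\<close> has row sums below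
  \<open>f\<^sub>i\<close>, column sums below \<open>g\<^sub>j\<close>, and \<open>f'\<^sub>i / D \<le> \<Sum>\<^sub>j h\<^sub>i\<^sub>j\<close>. Applying this again to the complements of the
  \<open>h\<^sub>i\<^sub>j\<close> in the rows and columns improves a constant \<open>c\<close> to almost \<open>1 / D + (1 - 1 / D) c\<close>; no
  cancellation is needed for this lower bound. Iteration gives every constant below \<open>1\<close>, which
  suffices because \<open>f' \<lless> f\<close> in \<open>S_R\<close> leaves a factor to spare. The complements have to be taken with
  a multiplicative error, which is achieved by averaging over long chains \<open>s\<^sub>0 \<lless> s\<^sub>1 \<lless> \<dots>\<close>.
\<close>

subsection \<open>Additive functions below a sublinear one\<close>

text \<open>The obstacle is the value infinity. A common summand cannot be cancelled where it is
  infinite, and an additive error \<open>e * g\<close> cannot be absorbed into a complement that is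
  finite where \<open>g\<close> is infinite; hence only multiplicative errors are carried along.
  Moreover the order of functions is coarser than that of \<open>S\<close>: it returns information
  about \<open>S\<close> only for multiples, up to a factor close to 1 and after shrinking
  \<open>s\<close> to some \<open>s' \<lless> s\<close>. Each such passage costs a factor and an
  interpolation, and both are paid out of \<open>f' \<lless> f\<close>. The limiting form of the
  improvement is the affine map from \<open>c\<close> to \<open>1 / D + (1 - 1 / D) * c\<close>, a
  contraction with fixed point 1, so its iterates approach 1. The factors by which pieces are scaled
  are rational because these preserve the functions \<open>hat s / k\<close>.\<close>

primrec nmul :: "nat \<Rightarrow> 'a::comm_monoid_add \<Rightarrow> 'a" where
  "nmul 0 x = 0"
| "nmul (Suc n) x = x + nmul n x"

lemma nmul_zero_right [simp]: "nmul n 0 = 0"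
  by (induction n) auto

lemma nmul_add_left: "nmul (m + n) x = nmul m x + nmul n x"
  by (induction m) (auto simp: add_ac)

lemma nmul_add_right: "nmul n (x + y) = nmul n x + nmul n y"
  by (induction n) (auto simp: add_ac)

lemma nmul_nmul: "nmul m (nmul n x) = nmul (m * n) x"
  by (induction m) (auto simp: nmul_add_left)

lemma nmul_sum: "nmul n (\<Sum>i\<in>I. f i) = (\<Sum>i\<in>I. nmul n (f i))"
  by (induction I rule: infinite_finite_induct) (auto simp: nmul_add_right)

lemma nmul_mono: "x \<le> y \<Longrightarrow> nmul n x \<le> nmul n (y::'a::ordered_comm_monoid_add)"
  by (induction n) (auto intro: add_mono)

lemma nmul_mono_left: "m \<le> n \<Longrightarrow> nmul m x \<le> nmul n (x::'a::ordered_semigroup)"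
  by (auto simp: nmul_add_left le_iff_add intro!: add_increasing2 zero_least)

text \<open>Only integer multiples exist in \<open>S\<close>, so homogeneity is required for these,
  and only in the direction that subadditivity does not give; see
  \<open>sublinear_nmul\<close>.\<close>

definition sublinear :: "('a::ordered_semigroup \<Rightarrow> ennreal) \<Rightarrow> bool" where
  "sublinear p \<longleftrightarrow> mono p \<and> p 0 = 0 \<and> (\<forall>x y. p (x + y) \<le> p x + p y) \<and>
     (\<forall>n x. of_nat n * p x \<le> p (nmul n x))"

text \<open>The infima are handled one at a time, by moving a finite summand to the other side; an
  infinite one makes the bound trivial. This yields subadditivity of the infima built below.\<close>

lemma le_INF_add_INF:
  fixes f :: "'i \<Rightarrow> ennreal" and g :: "'j \<Rightarrow> ennreal"
  assumes "\<And>i j. i \<in> I \<Longrightarrow> j \<in> J \<Longrightarrow> L \<le> f i + g j"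
  shows "L \<le> (INF i\<in>I. f i) + (INF j\<in>J. g j)"
proof -
  have flip: "L \<le> c + (INF k\<in>K. h k)" if "\<And>k. k \<in> K \<Longrightarrow> L \<le> c + h k"
    for c and K :: "'k set" and h :: "'k \<Rightarrow> ennreal"
  proof (cases "c = top")
    case False
    then have "L - c \<le> (INF k\<in>K. h k)"
      using that by (intro INF_greatest) (simp add: ennreal_minus_le_iff)
    with False show ?thesis
      by (simp add: ennreal_minus_le_iff)
  qed simp
  have "L \<le> (INF j\<in>J. g j) + f i" if "i \<in> I" for i
    using flip[of J "f i" g] assms that by (simp add: add.commute)
  then show ?thesis
    using flip[of I "INF j\<in>J. g j" f] by (simp add: add.commute)
qed

lemma sublinearD:
  assumes "sublinear p"
  shows "x \<le> y \<Longrightarrow> p x \<le> p y" "p 0 = 0" "p (x + y) \<le> p x + p y"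
    "of_nat n * p x \<le> p (nmul n x)"
  using assms by (auto simp: sublinear_def mono_def)

lemma sublinear_nmul:
  assumes "sublinear p"
  shows "p (nmul n x) = of_nat n * p x"
proof (rule antisym)
  show "p (nmul n x) \<le> of_nat n * p x"
  proof (induction n)
    case (Suc n)
    have "p (nmul (Suc n) x) \<le> p x + p (nmul n x)"
      using sublinearD(3)[OF assms] by simp
    also have "\<dots> \<le> p x + of_nat n * p x"
      using Suc by (intro add_left_mono)
    finally show ?case by (simp add: distrib_right)
  qed (simp add: sublinearD[OF assms])
qed (rule sublinearD(4)[OF assms])

text \<open>The asymptotic increment of \<open>p\<close> in direction \<open>b\<close>, which plays
  the role of the one-step extension in Hahn--Banach. If \<open>p b\<close> is finite, it is a
  sublinear function below \<open>p\<close> that is additive in direction \<open>b\<close>.\<close>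

definition slope :: "('a::ordered_semigroup \<Rightarrow> ennreal) \<Rightarrow> 'a \<Rightarrow> 'a \<Rightarrow> ennreal" where
  "slope p b x = (INF n. p (x + nmul n b) - of_nat n * p b)"

context
  fixes p :: "'a::ordered_semigroup \<Rightarrow> ennreal" and b :: 'a
  assumes p: "sublinear p" and b: "p b < \<infinity>"
begin

text \<open>The truncated subtraction of \<open>ennreal\<close> is exact here, since
  \<open>of_nat n * p b = p (nmul n b)\<close> is below \<open>p (x + nmul n b)\<close>.\<close>

lemma slope_diff: "p (x + nmul n b) = (p (x + nmul n b) - of_nat n * p b) + of_nat n * p b"
proof -
  have "of_nat n * p b \<le> p (x + nmul n b)"
    using sublinear_nmul[OF p, of n b] sublinearD(1)[OF p, of "nmul n b" "x + nmul n b"]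
    by (simp add: add_increasing zero_least)
  then show ?thesis
    by (simp add: diff_add_cancel_ennreal)
qed

lemma slope_diff_le: "p (x + nmul n b) \<le> c + of_nat n * p b \<Longrightarrow> p (x + nmul n b) - of_nat n * p b \<le> c"
  using b by (auto simp: ennreal_minus_le_iff add.commute ennreal_mult_eq_top_iff)

text \<open>Subadditivity bounds the growth from \<open>m\<close> to \<open>n\<close> by
  \<open>p (nmul (n - m) b)\<close>. So the infimum in \<open>slope\<close> is a limit, and finitely
  many terms may be dropped.\<close>

lemma slope_diff_antimono:
  assumes "m \<le> n"
  shows "p (x + nmul n b) - of_nat n * p b \<le> p (x + nmul m b) - of_nat m * p b"
proof (rule slope_diff_le)
  obtain k where k: "n = m + k" using assms le_Suc_ex by blast
  have "p (x + nmul n b) \<le> p (x + nmul m b) + p (nmul k b)"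
    using sublinearD(3)[OF p, of "x + nmul m b" "nmul k b"] by (simp add: k nmul_add_left add_ac)
  also have "\<dots> = (p (x + nmul m b) - of_nat m * p b) + of_nat m * p b + of_nat k * p b"
    using slope_diff[of x m] sublinear_nmul[OF p] by metis
  finally show "p (x + nmul n b) \<le> p (x + nmul m b) - of_nat m * p b + of_nat n * p b"
    by (simp add: k distrib_right add_ac)
qed

lemma slope_le: "slope p b x \<le> p x"
  unfolding slope_def by (rule INF_lower2[of 0]) auto

text \<open>Additivity in an earlier direction survives a slope in a new one; this keeps slopes
  inside the set to which Zorn's lemma is applied.\<close>

lemma slope_add_const:
  assumes a: "\<And>x. p (x + a) = p x + c"
  shows "slope p b (x + a) = slope p b x + c"
proof -
  have "p (x + a + nmul n b) - of_nat n * p b = p (x + nmul n b) - of_nat n * p b + c" for n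
  proof -
    have fin: "of_nat n * p b \<noteq> \<infinity>"
      using b by (simp add: ennreal_mult_eq_top_iff)
    have "p (x + a + nmul n b) = p (x + nmul n b) + c"
      using a[of "x + nmul n b"] by (simp add: add_ac)
    also have "\<dots> = (p (x + nmul n b) - of_nat n * p b + c) + of_nat n * p b"
      using slope_diff[of x n] by (metis add.assoc add.commute)
    finally show ?thesis
      by (simp add: ennreal_add_diff_cancel[OF fin])
  qed
  then show ?thesis
    unfolding slope_def by (simp add: INF_ennreal_add_const)
qed

lemma slope_add_base: "slope p b (x + b) = slope p b x + p b"
proof -
  define D where "D n = p (x + nmul n b) - of_nat n * p b" for n
  have "p (x + b + nmul n b) - of_nat n * p b = D (Suc n) + p b" for n
  proof -
    have fin: "of_nat n * p b \<noteq> \<infinity>"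
      using b by (simp add: ennreal_mult_eq_top_iff)
    have "p (x + b + nmul n b) = D (Suc n) + p b + of_nat n * p b"
      using slope_diff[of x "Suc n"] by (simp add: D_def add_ac distrib_right)
    then show ?thesis
      by (simp add: ennreal_add_diff_cancel[OF fin])
  qed
  then have "slope p b (x + b) = (INF n. D (Suc n)) + p b"
    unfolding slope_def by (simp add: INF_ennreal_add_const)
  \<comment> \<open>Adding \<open>b\<close> has shifted the index by one; the terms decrease, so the
    infimum is unchanged.\<close>
  also have "(INF n. D (Suc n)) = (INF n. D n)"
  proof (rule antisym)
    show "(INF n. D (Suc n)) \<le> (INF n. D n)"
      unfolding D_def by (rule INF_mono) (use slope_diff_antimono[OF le_SucI[OF order_refl]] in blast)
    show "(INF n. D n) \<le> (INF n. D (Suc n))"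
      by (rule INF_greatest) (rule INF_lower[OF UNIV_I])
  qed
  finally show ?thesis
    by (simp add: slope_def D_def)
qed

lemma sublinear_slope: "sublinear (slope p b)"
  unfolding sublinear_def
proof (intro conjI allI monoI)
  fix x y :: 'a assume "x \<le> y"
  then show "slope p b x \<le> slope p b y"
    unfolding slope_def
    by (intro INF_mono) (force intro!: ennreal_minus_mono sublinearD(1)[OF p] add_right_mono)
next
  show "slope p b 0 = 0"
    using slope_le[of 0] sublinearD(2)[OF p] by simp
next
  fix x y
  show "slope p b (x + y) \<le> slope p b x + slope p b y"
    unfolding slope_def[of p b x] slope_def[of p b y]
  proof (rule le_INF_add_INF)
    fix m n
    have "p ((x + y) + nmul (m + n) b) \<le> p (x + nmul m b) + p (y + nmul n b)"
      using sublinearD(3)[OF p, of "x + nmul m b" "y + nmul n b"] by (simp add: nmul_add_left add_ac)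
    also have "\<dots> = (p (x + nmul m b) - of_nat m * p b) + (p (y + nmul n b) - of_nat n * p b)
        + of_nat (m + n) * p b"
      by (subst slope_diff[of x m], subst slope_diff[of y n]) (simp add: distrib_right add_ac)
    finally have "p ((x + y) + nmul (m + n) b) - of_nat (m + n) * p b
        \<le> (p (x + nmul m b) - of_nat m * p b) + (p (y + nmul n b) - of_nat n * p b)"
      by (rule slope_diff_le)
    then show "slope p b (x + y)
        \<le> (p (x + nmul m b) - of_nat m * p b) + (p (y + nmul n b) - of_nat n * p b)"
      unfolding slope_def by (rule INF_lower2[OF UNIV_I])
  qed
next
  fix k x
  show "of_nat k * slope p b x \<le> slope p b (nmul k x)"
  proof (cases "k = 0")
    case False
    show ?thesis
      unfolding slope_def[of p b "nmul k x"]
    proof (rule INF_greatest)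
      fix n
      have fin: "of_nat k * of_nat n * p b \<noteq> \<infinity>"
        using b by (simp add: ennreal_mult_eq_top_iff)
      have "of_nat k * slope p b x \<le> of_nat k * (p (x + nmul n b) - of_nat n * p b)"
        unfolding slope_def by (intro mult_left_mono INF_lower) auto
      also have "of_nat k * p (x + nmul n b) = of_nat k * (p (x + nmul n b) - of_nat n * p b)
          + of_nat k * of_nat n * p b"
        by (subst slope_diff[of x n]) (simp add: distrib_left mult.assoc)
      then have "of_nat k * (p (x + nmul n b) - of_nat n * p b)
          = of_nat k * p (x + nmul n b) - of_nat k * of_nat n * p b"
        by (simp add: ennreal_add_diff_cancel[OF fin])
      \<comment> \<open>Multiplication by \<open>k\<close> leads to the term of index
        \<open>k * n\<close>, which is at most the term of index \<open>n\<close>.\<close>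
      also have "\<dots> \<le> p (nmul k x + nmul (k * n) b) - of_nat (k * n) * p b"
        using sublinearD(4)[OF p, of k "x + nmul n b"]
        by (intro ennreal_minus_mono) (auto simp: nmul_add_right nmul_nmul)
      also have "\<dots> \<le> p (nmul k x + nmul n b) - of_nat n * p b"
        using False by (intro slope_diff_antimono) simp
      finally show "of_nat k * slope p b x \<le> p (nmul k x + nmul n b) - of_nat n * p b" .
    qed
  qed simp
qed

end

text \<open>Supplies the bounds for Zorn's lemma. In the proof of subadditivity two members, one
  evaluated at \<open>x\<close> and one at \<open>y\<close>, are replaced by the smaller of
  them.\<close>

lemma sublinear_INF_chain:
  fixes C :: "('a::ordered_semigroup \<Rightarrow> ennreal) set"
  assumes ne: "C \<noteq> {}" and C: "\<And>q. q \<in> C \<Longrightarrow> sublinear q"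
    and chain: "\<And>q r. q \<in> C \<Longrightarrow> r \<in> C \<Longrightarrow> q \<le> r \<or> r \<le> q"
  shows "sublinear (\<lambda>x. INF q\<in>C. q x)"
  unfolding sublinear_def
proof (intro conjI allI monoI)
  fix x y :: 'a assume "x \<le> y"
  then show "(INF q\<in>C. q x) \<le> (INF q\<in>C. q y)"
    by (intro INF_mono) (use sublinearD(1)[OF C] in blast)
next
  obtain q where "q \<in> C" using ne by blast
  then have "(INF q\<in>C. q 0) \<le> 0"
    using sublinearD(2)[OF C] by (intro INF_lower2[of q]) auto
  then show "(INF q\<in>C. q 0) = 0" by simp
next
  fix x y
  show "(INF q\<in>C. q (x + y)) \<le> (INF q\<in>C. q x) + (INF q\<in>C. q y)"
  proof (rule le_INF_add_INF)
    fix q r assume qr: "q \<in> C" "r \<in> C"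
    then obtain t where t: "t \<in> C" "t \<le> q" "t \<le> r"
      using chain by blast
    have "(INF q\<in>C. q (x + y)) \<le> t (x + y)"
      using t by (intro INF_lower)
    also have "\<dots> \<le> t x + t y"
      by (rule sublinearD(3)[OF C[OF t(1)]])
    also have "\<dots> \<le> q x + r y"
      using t by (intro add_mono) (auto simp: le_fun_def)
    finally show "(INF q\<in>C. q (x + y)) \<le> q x + r y" .
  qed
next
  fix n x
  show "of_nat n * (INF q\<in>C. q x) \<le> (INF q\<in>C. q (nmul n x))"
  proof (rule INF_greatest)
    fix q assume q: "q \<in> C"
    have "of_nat n * (INF q\<in>C. q x) \<le> of_nat n * q x"
      using q by (intro mult_left_mono INF_lower) auto
    also have "\<dots> \<le> q (nmul n x)"
      by (rule sublinearD(4)[OF C[OF q]])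
    finally show "of_nat n * (INF q\<in>C. q x) \<le> q (nmul n x)" .
  qed
qed

lemma INF_add_const_ennreal:
  fixes f :: "'i \<Rightarrow> ennreal"
  assumes "I \<noteq> {}"
  shows "(INF i\<in>I. f i + c) = (INF i\<in>I. f i) + c"
proof (rule antisym)
  show "(INF i\<in>I. f i + c) \<le> (INF i\<in>I. f i) + c"
    using le_INF_add_INF[of I "{()}" "INF i\<in>I. f i + c" f "\<lambda>_. c"] by (auto intro: INF_lower)
  show "(INF i\<in>I. f i) + c \<le> (INF i\<in>I. f i + c)"
    using assms by (intro INF_greatest add_right_mono INF_lower)
qed

text \<open>
  A minimal sublinear function among those below \<open>p\<close> that are additive in the direction \<open>a\<close> equals
  all its slopes, hence is additive in every direction in which it is finite; in the remaining
  directions additivity follows from monotonicity.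
\<close>

lemma exists_additive_below_finite:
  fixes p :: "'a::ordered_semigroup \<Rightarrow> ennreal"
  assumes p: "sublinear p" and a: "p a < \<infinity>"
  obtains l where "mono l" "l 0 = 0" "\<And>x y. l (x + y) = l x + l y" "\<And>x. l x \<le> p x" "l a = p a"
proof -
  \<comment> \<open>Fixing the increment in direction \<open>a\<close> keeps minimization from
    lowering the value at \<open>a\<close>: the case \<open>x = 0\<close> gives
    \<open>q a = p a\<close>.\<close>
  define A where "A = {q. sublinear q \<and> q \<le> p \<and> (\<forall>x. q (x + a) = q x + p a)}"
  have slopeA: "slope p a \<in> A"
    using sublinear_slope[OF p a] slope_le[OF p a] slope_add_base[OF p a]
    by (auto simp: A_def le_fun_def)
  \<comment> \<open>Zorn's lemma for the reversed order, so that maximal means pointwise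
    minimal.\<close>
  have "\<exists>m\<in>A. \<forall>q\<in>A. (\<lambda>q r. r \<le> q) m q \<longrightarrow> q = m"
  proof (rule predicate_Zorn)
    show "partial_order_on A (relation_of (\<lambda>q r. r \<le> q) A)"
      by (rule partial_order_on_relation_ofI) auto
  next
    fix C assume C: "C \<in> Chains (relation_of (\<lambda>q r. r \<le> q) A)"
    then have CA: "C \<subseteq> A"
      by (rule Chains_relation_of)
    have chain: "q \<le> r \<or> r \<le> q" if "q \<in> C" "r \<in> C" for q r
      using C that unfolding Chains_def relation_of_def by auto
    show "\<exists>u\<in>A. \<forall>q\<in>C. u \<le> q"
    proof (cases "C = {}")
      case True
      then show ?thesis using slopeA by blast
    next
      case False
      define u where "u = (\<lambda>x. INF q\<in>C. q x)"
      have "sublinear u"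
        unfolding u_def by (rule sublinear_INF_chain[OF False]) (use CA chain in \<open>auto simp: A_def\<close>)
      moreover have "u \<le> p"
      proof -
        obtain q where "q \<in> C" using False by blast
        then show ?thesis
          using CA unfolding u_def le_fun_def A_def
          by (auto intro!: INF_lower2[of q] simp: le_fun_def)
      qed
      moreover have "u (x + a) = u x + p a" for x
      proof -
        have "u (x + a) = (INF q\<in>C. q x + p a)"
          unfolding u_def by (intro INF_cong) (use CA in \<open>auto simp: A_def\<close>)
        then show ?thesis
          by (simp add: INF_add_const_ennreal[OF False] u_def)
      qed
      moreover have "\<forall>q\<in>C. u \<le> q"
        by (auto simp: u_def le_fun_def intro: INF_lower)
      ultimately show ?thesis
        by (auto simp: A_def)
    qed
  qed
  then obtain q where q: "q \<in> A" and min: "\<And>r. r \<in> A \<Longrightarrow> r \<le> q \<Longrightarrow> r = q"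
    by blast
  have sub: "sublinear q" and qp: "q \<le> p" and qa: "\<And>x. q (x + a) = q x + p a"
    using q by (auto simp: A_def)
  have add: "q (x + y) = q x + q y" for x y
  proof (cases "q y < \<infinity>")
    case True
    have "slope q y \<le> q"
      using slope_le[OF sub True] by (simp add: le_fun_def)
    moreover from this have "slope q y \<in> A"
      using sublinear_slope[OF sub True] slope_add_const[OF sub True qa] qp
      by (auto simp: A_def intro: order_trans)
    ultimately have "slope q y = q"
      by (intro min)
    then show ?thesis
      using slope_add_base[OF sub True, of x] by simp
  next
    case False
    then have "q y = \<infinity>" by (simp add: less_top[symmetric])
    moreover have "q y \<le> q (x + y)"
      by (intro sublinearD(1)[OF sub] add_increasing zero_least order_refl)
    ultimately show ?thesis by (simp add: top_unique)
  qed
  show thesis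
  proof (rule that)
    show "mono q" "q 0 = 0"
      using sub by (auto simp: sublinear_def)
    show "q x \<le> p x" for x
      using qp by (simp add: le_fun_def)
    show "q a = p a"
      using qa[of 0] sublinearD(2)[OF sub] by simp
  qed (rule add)
qed

text \<open>If \<open>p a\<close> is infinite, the map that is 0 where \<open>p\<close> is finite
  and infinite elsewhere will do. It is additive because \<open>p (x + y)\<close> is finite exactly
  if \<open>p x\<close> and \<open>p y\<close> are.\<close>

lemma exists_additive_below:
  fixes p :: "'a::ordered_semigroup \<Rightarrow> ennreal"
  assumes p: "sublinear p"
  obtains l where "mono l" "l 0 = 0" "\<And>x y. l (x + y) = l x + l y" "\<And>x. l x \<le> p x" "l a = p a"
proof (cases "p a < \<infinity>")
  case True
  then show thesis
    using exists_additive_below_finite[OF p] that by metis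
next
  case False
  define l where "l x = (if p x < \<infinity> then 0 else \<infinity> :: ennreal)" for x
  have fin: "p (x + y) < \<infinity> \<longleftrightarrow> p x < \<infinity> \<and> p y < \<infinity>" for x y
  proof -
    have "p x \<le> p (x + y)" "p y \<le> p (x + y)"
      by (intro sublinearD(1)[OF p] add_increasing add_increasing2 zero_least order_refl)+
    moreover have "p (x + y) \<le> p x + p y"
      by (rule sublinearD(3)[OF p])
    ultimately show ?thesis
      by (auto simp: less_top[symmetric] top_unique)
  qed
  show thesis
  proof (rule that[of l])
    show "mono l"
    proof (rule monoI)
      fix x y :: 'a assume "x \<le> y"
      then show "l x \<le> l y"
        using sublinearD(1)[OF p, of x y] le_less_trans[of "p x" "p y" \<infinity>] by (auto simp: l_def)
    qed
    show "l (x + y) = l x + l y" for x y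
      using fin[of x y] by (auto simp: l_def)
    show "l x \<le> p x" for x
      by (auto simp: l_def less_top[symmetric])
  qed (use False in \<open>auto simp: l_def sublinearD[OF p] less_top[symmetric]\<close>)
qed

subsection \<open>Comparison in the semigroup and in its functionals\<close>

abbreviation way_below_UNIV (infix "\<lless>" 50) where
  "s \<lless> t \<equiv> way_below UNIV s t"

lemma ev_functional: "is_functional (ev \<phi>)"
  using functional.ev[of \<phi>] by simp

lemma ev_0 [simp]: "ev \<phi> 0 = 0"
  using ev_functional[of \<phi>] by (simp add: is_functional_def)

lemma ev_add [simp]: "ev \<phi> (s + t) = ev \<phi> s + ev \<phi> t"
  using ev_functional[of \<phi>] by (simp add: is_functional_def)

lemma ev_mono: "s \<le> t \<Longrightarrow> ev \<phi> s \<le> ev \<phi> t"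
  using ev_functional[of \<phi>] by (simp add: is_functional_def mono_def)

lemma ev_lub: "incseq T \<Longrightarrow> isLub UNIV (range T) u \<Longrightarrow> ev \<phi> u = (SUP n. ev \<phi> (T n))"
  using ev_functional[of \<phi>] by (simp add: is_functional_def)

lemma ev_nmul [simp]: "ev \<phi> (nmul n s) = of_nat n * ev \<phi> s"
  by (induction n) (auto simp: distrib_right)

lemma ev_sum [simp]: "ev \<phi> (\<Sum>i\<in>I. s i) = (\<Sum>i\<in>I. ev \<phi> (s i))"
  by (induction I rule: infinite_finite_induct) auto

lemma way_below_lubD:
  "s \<lless> t \<Longrightarrow> incseq T \<Longrightarrow> isLub UNIV (range T) u \<Longrightarrow> t \<le> u \<Longrightarrow> \<exists>n. s \<le> T n"
  by (auto simp: way_below_def)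

lemma way_below_zeroD: "s \<lless> 0 \<Longrightarrow> s = (0::'a::ordered_semigroup)"
  using way_below_imp_le[of s 0] zero_least[of s] by simp

section \<open>Interpolation, functionals from additive maps, and the comparison lemmas\<close>

locale Cu_semigroup =
  fixes ty :: "'a::ordered_semigroup itself"
  assumes O2: "axiom_O2 TYPE('a)" and O3: "axiom_O3 TYPE('a)"
    and O4: "axiom_O4 TYPE('a)" and O5: "axiom_O5 TYPE('a)" and O6: "axiom_O6 TYPE('a)"
begin

lemma interpolate:
  fixes s t :: 'a
  assumes "s \<lless> t" obtains u where "s \<lless> u" "u \<lless> t"
  using way_below_interpolate[OF O2 assms] .

lemma way_below_add: "s \<lless> t \<Longrightarrow> s' \<lless> t' \<Longrightarrow> s + s' \<lless> t + (t'::'a)"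
  using O3 by (auto simp: axiom_O3_def)

lemma way_below_nmul: "s \<lless> t \<Longrightarrow> nmul n s \<lless> nmul n (t::'a)"
  by (induction n) (auto intro: way_below_add way_below_zero)

lemma way_below_sum: "(\<And>i. i \<in> I \<Longrightarrow> s i \<lless> t i) \<Longrightarrow> (\<Sum>i\<in>I. s i) \<lless> (\<Sum>i\<in>I. t i :: 'a)"
  by (induction I rule: infinite_finite_induct) (auto intro: way_below_add way_below_zero)

lemma approximating_sequence:
  obtains T where "incseq T" "\<And>n. T n \<lless> T (Suc n)" "isLub UNIV (range T) (s::'a)"
    "\<And>n. T n \<lless> s"
proof -
  obtain T where T: "\<And>n. T n \<lless> T (Suc n)" "isLub UNIV (range T) s"
    using O2 unfolding axiom_O2_def by blast
  moreover have "incseq T"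
    using T by (intro incseq_SucI way_below_imp_le)
  moreover have "T n \<lless> s" for n
    using way_below_mono[OF order_refl T(1) isLubD2[OF T(2) rangeI]] .
  ultimately show thesis using that by blast
qed

lemma way_below_chain:
  assumes "s \<lless> (t::'a)"
  obtains T where "\<And>n. s \<le> T n" "\<And>n. T n \<lless> T (Suc n)" "\<And>n. T n \<lless> t"
proof -
  obtain T where T: "incseq T" "\<And>n. T n \<lless> T (Suc n)" "isLub UNIV (range T) t"
    "\<And>n. T n \<lless> t"
    using approximating_sequence[of t] by blast
  obtain n where "s \<le> T n"
    using way_below_lubD[OF assms T(1,3)] by blast
  then have "s \<le> T (n + k)" for k
    using incseqD[OF T(1), of n "n + k"] by auto
  then show thesis
    using T(2,4) by (intro that[of "\<lambda>k. T (n + k)"]) auto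
qed

text \<open>By O4 the sums of approximating sequences of \<open>x\<close> and \<open>y\<close> have
  supremum \<open>x + y\<close>, so \<open>s\<close> is below one of these sums.\<close>

lemma way_below_addE:
  assumes "s \<lless> x + (y::'a)"
  obtains x' y' where "x' \<lless> x" "y' \<lless> y" "s \<le> x' + y'"
proof -
  obtain X where X: "incseq X" "isLub UNIV (range X) x" "\<And>n. X n \<lless> x"
    by (rule approximating_sequence[of x]) (rule that)
  obtain Y where Y: "incseq Y" "isLub UNIV (range Y) y" "\<And>n. Y n \<lless> y"
    by (rule approximating_sequence[of y]) (rule that)
  have lub: "isLub UNIV (range (\<lambda>n. X n + Y n)) (x + y)"
    using O4[unfolded axiom_O4_def, rule_format, OF conjI, of X Y x y] X(1,2) Y(1,2) by simp
  have inc: "incseq (\<lambda>n. X n + Y n)"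
    using X(1) Y(1) by (auto simp: incseq_def intro: add_mono)
  obtain n where "s \<le> X n + Y n"
    using way_below_lubD[OF assms inc lub order_refl] by auto
  then show thesis
    by (rule that[OF X(3) Y(3)])
qed

text \<open>Hahn--Banach yields additive monotone maps that need not preserve suprema of sequences.
  This repairs them at little cost: for monotone \<open>l\<close> and \<open>s' \<lless> s\<close>
  the new value at \<open>s\<close> lies between \<open>l s'\<close> and \<open>l s\<close>.\<close>

definition regularize :: "('a \<Rightarrow> ennreal) \<Rightarrow> 'a \<Rightarrow> ennreal" where
  "regularize l s = (SUP s'\<in>{s'. s' \<lless> s}. l s')"

text \<open>O3 gives superadditivity, O4 through \<open>way_below_addE\<close> gives subadditivity,
  and interpolation gives the suprema.\<close>

lemma is_functional_regularize:
  assumes mono: "mono l" and zero: "l 0 = 0" and add: "\<And>x y. l (x + y) = l x + l y"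
  shows "is_functional (regularize l)"
  unfolding is_functional_def
proof (intro conjI allI monoI impI)
  fix s t :: 'a
  show "regularize l (s + t) = regularize l s + regularize l t"
  proof (rule antisym)
    show "regularize l (s + t) \<le> regularize l s + regularize l t"
      unfolding regularize_def[of l "s + t"]
    proof (rule SUP_least)
      fix x assume "x \<in> {x. x \<lless> s + t}"
      then obtain s' t' where s': "s' \<lless> s" "t' \<lless> t" "x \<le> s' + t'"
        using way_below_addE by blast
      have "l x \<le> l s' + l t'"
        using monoD[OF mono s'(3)] add by simp
      also have "\<dots> \<le> regularize l s + regularize l t"
        unfolding regularize_def using s' by (intro add_mono SUP_upper) auto
      finally show "l x \<le> regularize l s + regularize l t" .
    qed
    have "l s' + l t' \<le> regularize l (s + t)" if "s' \<lless> s" "t' \<lless> t" for s' t'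
      unfolding regularize_def using way_below_add[OF that] add
      by (intro SUP_upper2[of "s' + t'"]) auto
    then have "(SUP t'\<in>{t'. t' \<lless> t}. l s' + l t') \<le> regularize l (s + t)" if "s' \<lless> s" for s'
      using that by (intro SUP_least) auto
    then have "l s' + regularize l t \<le> regularize l (s + t)" if "s' \<lless> s" for s'
      using that way_below_zero[of t] unfolding regularize_def[of l t]
      by (subst ennreal_SUP_add_right) auto
    then have "(SUP s'\<in>{s'. s' \<lless> s}. l s' + regularize l t) \<le> regularize l (s + t)"
      by (intro SUP_least) auto
    then show "regularize l s + regularize l t \<le> regularize l (s + t)"
      using way_below_zero[of s] unfolding regularize_def[of l s]
      by (subst ennreal_SUP_add_left[symmetric]) auto
  qed
next
  fix s t :: 'a assume "s \<le> t"
  then show "regularize l s \<le> regularize l t"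
    unfolding regularize_def
    by (intro SUP_subset_mono) (auto intro: way_below_mono[OF order_refl])
next
  show "regularize l 0 = 0"
    unfolding regularize_def
    by (intro antisym SUP_least) (auto dest!: way_below_zeroD simp: zero)
next
  fix T :: "nat \<Rightarrow> 'a" and u assume T: "incseq T \<and> isLub UNIV (range T) u"
  show "regularize l u = (SUP n. regularize l (T n))"
  proof (rule antisym)
    show "regularize l u \<le> (SUP n. regularize l (T n))"
      unfolding regularize_def[of l u]
    proof (rule SUP_least)
      fix x assume "x \<in> {x. x \<lless> u}"
      then obtain y where y: "x \<lless> y" "y \<lless> u"
        using interpolate by blast
      then obtain n where "y \<le> T n"
        using way_below_lubD[OF y(2)] T by blast
      then have "x \<lless> T n"
        using way_below_mono[OF order_refl y(1)] by blast
      then show "l x \<le> (SUP n. regularize l (T n))"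
        by (intro SUP_upper2[of n]) (auto simp: regularize_def intro: SUP_upper)
    qed
    have "T n \<le> u" for n
      using T by (meson isLubD2 rangeI)
    then show "(SUP n. regularize l (T n)) \<le> regularize l u"
      unfolding regularize_def
      by (intro SUP_least SUP_subset_mono) (auto intro: way_below_mono[OF order_refl])
  qed
qed

text \<open>
  \<open>R r x\<close> is read as ``\<open>x\<close> is at most \<open>r\<close>''; the least such \<open>r\<close> is a sublinear function of \<open>x\<close>.
\<close>

lemma gauge_compare:
  fixes R :: "ennreal \<Rightarrow> 'a \<Rightarrow> bool"
  assumes zero: "R 0 0"
    and down: "\<And>r x y. x \<le> y \<Longrightarrow> R r y \<Longrightarrow> R r x"
    and add: "\<And>r x r' y. R r x \<Longrightarrow> R r' y \<Longrightarrow> R (r + r') (x + y)"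
    and div: "\<And>r x n. 0 < n \<Longrightarrow> R r (nmul n x) \<Longrightarrow> R (r / of_nat n) x"
    and bound: "\<And>\<phi>. (\<And>r x. R r x \<Longrightarrow> ev \<phi> x \<le> r) \<Longrightarrow> ev \<phi> s < c"
    and s: "s' \<lless> s"
  obtains r where "r < c" "R r s'"
proof -
  define p where "p x = Inf {r. R r x}" for x
  have p: "sublinear p"
    unfolding sublinear_def
  proof (intro conjI allI monoI)
    fix x y :: 'a assume "x \<le> y"
    then show "p x \<le> p y"
      unfolding p_def using down by (intro Inf_superset_mono) auto
  next
    have "p 0 \<le> 0"
      unfolding p_def using zero by (intro Inf_lower) auto
    then show "p 0 = 0" by simp
  next
    fix x y
    have "p (x + y) \<le> (INF r\<in>{r. R r x}. r) + (INF r\<in>{r. R r y}. r)"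
      unfolding p_def by (intro le_INF_add_INF Inf_lower) (auto intro: add)
    then show "p (x + y) \<le> p x + p y"
      by (simp add: p_def)
  next
    fix n x
    show "of_nat n * p x \<le> p (nmul n x)"
    proof (cases "n = 0")
      case False
      then have n: "(of_nat n :: ennreal) \<noteq> 0" "(of_nat n :: ennreal) \<noteq> top"
        by auto
      show ?thesis
        unfolding p_def[of "nmul n x"]
      proof (rule Inf_greatest)
        fix r assume "r \<in> {r. R r (nmul n x)}"
        with False have "p x \<le> r / of_nat n"
          unfolding p_def by (intro Inf_lower) (auto intro: div)
        then have "of_nat n * p x \<le> of_nat n * (r / of_nat n)"
          by (intro mult_left_mono) auto
        also have "\<dots> = r"
          using n by (metis ennreal_times_divide mult.commute mult_divide_eq_ennreal)
        finally show "of_nat n * p x \<le> r" .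
      qed
    qed simp
  qed
  obtain l where l: "mono l" "l 0 = 0" "\<And>x y. l (x + y) = l x + l y" "\<And>x. l x \<le> p x" "l s' = p s'"
    using exists_additive_below[OF p, of s'] by blast
  define \<phi> where "\<phi> = Functional (regularize l)"
  have ev: "ev \<phi> x = regularize l x" for x
    unfolding \<phi>_def using is_functional_regularize[OF l(1-3)] by (subst Functional_inverse) auto
  have "ev \<phi> x \<le> l x" for x
    unfolding ev regularize_def
    by (intro SUP_least) (auto intro: monoD[OF l(1)] dest: way_below_imp_le)
  then have "ev \<phi> x \<le> r" if "R r x" for r x
    using that l(4)[of x] unfolding p_def by (auto intro: order_trans Inf_lower2)
  then have "ev \<phi> s < c"
    by (rule bound)
  \<comment> \<open>The gap between \<open>s'\<close> and \<open>s\<close> is spent here: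
    regularization may lower the value at \<open>s'\<close> itself.\<close>
  moreover have "l s' \<le> ev \<phi> s"
    unfolding ev regularize_def using s by (intro SUP_upper) auto
  ultimately have "p s' < c"
    using l(5) by simp
  then show thesis
    unfolding p_def Inf_less_iff using that by auto
qed

lemma ennreal_mult_divide_le:
  assumes "0 < n" "(of_nat n :: ennreal) * a \<le> r * b"
  shows "a \<le> (r / of_nat n) * b"
proof -
  have n: "(of_nat n :: ennreal) \<noteq> 0" "(of_nat n :: ennreal) \<noteq> top"
    using assms by auto
  have "of_nat n * ((r / of_nat n) * b) = r * b"
    using n by (metis ennreal_times_divide mult.assoc mult.commute mult_divide_eq_ennreal)
  then show ?thesis
    using assms(2) ennreal_mult_le_mult_iff[OF n] by metis
qed

text \<open>A Dini argument without compactness. A functional dominated by \<open>R\<close>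
  satisfies \<open>G i \<phi> \<le> 1\<close> for all \<open>i\<close>, because the element
  representing \<open>of_nat k * G i\<close> is related to \<open>of_nat k\<close>. Hence
  \<open>ev \<phi> s \<le> 1 < c\<close>, and \<open>gauge_compare\<close> returns a single index
  \<open>i\<close>.\<close>

lemma hat_le_SUP_imp:
  assumes G: "incseq G" and le: "\<And>\<phi>. ev \<phi> s \<le> (SUP i. G i \<phi>)"
    and rep: "\<And>i. \<exists>t k. 0 < k \<and> (\<forall>\<phi>. of_nat k * G i \<phi> = ev \<phi> (t::'a))"
    and c: "1 < c" and s: "s' \<lless> (s::'a)"
  obtains i where "\<And>\<phi>. ev \<phi> s' \<le> c * G i \<phi>"
proof -
  define R where "R r x \<longleftrightarrow> (\<exists>i. \<forall>\<phi>. ev \<phi> x \<le> r * G i \<phi>)" for r x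
  obtain r where r: "r < c" "R r s'"
  proof (rule gauge_compare[of R s c s'])
    show "R 0 0" by (auto simp: R_def)
  next
    fix r and x y :: 'a assume "x \<le> y" "R r y"
    then show "R r x"
      unfolding R_def using ev_mono order_trans by blast
  next
    fix r x r' y assume "R r x" "R r' y"
    then obtain i j where i: "\<And>\<phi>. ev \<phi> x \<le> r * G i \<phi>" and j: "\<And>\<phi>. ev \<phi> y \<le> r' * G j \<phi>"
      unfolding R_def by blast
    have "ev \<phi> (x + y) \<le> (r + r') * G (max i j) \<phi>" for \<phi>
    proof -
      have "ev \<phi> (x + y) \<le> r * G i \<phi> + r' * G j \<phi>"
        using i j by (simp add: add_mono)
      also have "\<dots> \<le> r * G (max i j) \<phi> + r' * G (max i j) \<phi>"
        using G by (intro add_mono mult_left_mono) (auto simp: incseq_def le_fun_def)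
      finally show ?thesis by (simp add: distrib_right)
    qed
    then show "R (r + r') (x + y)" unfolding R_def by blast
  next
    fix r x and n :: nat assume "0 < n" "R r (nmul n x)"
    then show "R (r / of_nat n) x"
      unfolding R_def using ennreal_mult_divide_le[of n] by (metis ev_nmul)
  next
    fix \<phi> assume dom: "\<And>r x. R r x \<Longrightarrow> ev \<phi> x \<le> r"
    have "G i \<phi> \<le> 1" for i
    proof -
      obtain t k where k: "0 < k" and t: "\<And>\<phi>. of_nat k * G i \<phi> = ev \<phi> (t::'a)"
        using rep by blast
      have "R (of_nat k) t"
        unfolding R_def using t by (metis order_refl)
      then have "of_nat k * G i \<phi> \<le> of_nat k * 1"
        using dom t by simp
      then show ?thesis
        using k by (subst (asm) ennreal_mult_le_mult_iff) auto
    qed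
    then show "ev \<phi> s < c"
      using le[of \<phi>] c by (meson SUP_least le_less_trans order_trans)
  qed (use s in auto)
  then obtain i where i: "\<And>\<phi>. ev \<phi> s' \<le> r * G i \<phi>"
    by (auto simp: R_def)
  have "ev \<phi> s' \<le> c * G i \<phi>" for \<phi>
    using i[of \<phi>] mult_right_mono[of r c "G i \<phi>"] r(1) by (auto intro: order_trans)
  then show thesis by (rule that)
qed

text \<open>Inequalities of functions return to \<open>S\<close> between multiples, at the cost of
  the factor \<open>(k + 1) / k\<close>. Here \<open>R\<close> relates \<open>x\<close> to the
  fractions \<open>N / M\<close> with \<open>nmul M x \<le> nmul N t\<close>; a functional dominated
  by it is at most 1 at \<open>t\<close>, hence at \<open>s\<close>.\<close>

lemma hat_le_imp_nmul_le:
  assumes le: "\<And>\<phi>. ev \<phi> s \<le> ev \<phi> t" and s: "s' \<lless> (s::'a)" and k: "0 < k"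
  obtains M where "0 < M" "nmul (M * k) s' \<le> nmul (M * Suc k) t"
proof -
  define R where "R r x \<longleftrightarrow> (\<exists>M N. 0 < M \<and> r = of_nat N / of_nat M \<and> nmul M x \<le> nmul N t)"
    for r :: ennreal and x
  have frac: "of_nat N / of_nat M = ennreal (real N / real M)" if "0 < M" for N M
    using that by (simp add: divide_ennreal ennreal_of_nat_eq_real_of_nat)
  obtain r where r: "r < ennreal (1 + 1 / real k)" "R r s'"
  proof (rule gauge_compare[of R s "ennreal (1 + 1 / real k)" s'])
    show "R 0 0"
      unfolding R_def by (rule exI[of _ 1], rule exI[of _ 0]) auto
  next
    fix r and x y :: 'a assume "x \<le> y" "R r y"
    then show "R r x"
      unfolding R_def using nmul_mono order_trans by metis
  next
    fix r x r' y assume "R r x" "R r' y"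
    then obtain M N M' N' where *: "0 < M" "r = of_nat N / of_nat M" "nmul M x \<le> nmul N t"
      "0 < M'" "r' = of_nat N' / of_nat M'" "nmul M' y \<le> nmul N' t"
      unfolding R_def by blast
    have "nmul (M * M') (x + y) = nmul M' (nmul M x) + nmul M (nmul M' y)"
      by (simp add: nmul_add_right nmul_nmul mult.commute)
    also have "\<dots> \<le> nmul M' (nmul N t) + nmul M (nmul N' t)"
      using * by (intro add_mono nmul_mono)
    also have "\<dots> = nmul (M' * N + M * N') t"
      by (simp add: nmul_nmul nmul_add_left)
    finally have "nmul (M * M') (x + y) \<le> nmul (M' * N + M * N') t" .
    moreover have "r + r' = of_nat (M' * N + M * N') / of_nat (M * M')"
    proof -
      have "r + r' = ennreal (real N / real M + real N' / real M')"
        using * frac by (simp add: ennreal_plus)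
      also have "real N / real M + real N' / real M' = real (M' * N + M * N') / real (M * M')"
        using *(1,4) by (simp add: field_simps)
      also have "ennreal \<dots> = of_nat (M' * N + M * N') / of_nat (M * M')"
        using *(1,4) by (intro frac[symmetric]) simp
      finally show ?thesis .
    qed
    ultimately show "R (r + r') (x + y)"
      unfolding R_def using * by (metis mult_pos_pos)
  next
    fix r x and n :: nat assume n: "0 < n" and "R r (nmul n x)"
    then obtain M N where *: "0 < M" "r = of_nat N / of_nat M" "nmul M (nmul n x) \<le> nmul N t"
      unfolding R_def by blast
    have "r / of_nat n = of_nat N / of_nat (M * n)"
    proof -
      have "r / of_nat n = ennreal (real N / real M) / ennreal (real n)"
        using * frac by (simp add: ennreal_of_nat_eq_real_of_nat)
      also have "\<dots> = ennreal (real N / real (M * n))"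
        using n by (subst divide_ennreal) (auto simp: field_simps)
      also have "\<dots> = of_nat N / of_nat (M * n)"
        using *(1) n by (intro frac[symmetric]) simp
      finally show ?thesis .
    qed
    then show "R (r / of_nat n) x"
      unfolding R_def using * n by (intro exI[of _ "M * n"] exI[of _ N]) (simp add: nmul_nmul)
  next
    fix \<phi> assume dom: "\<And>r x. R r x \<Longrightarrow> ev \<phi> x \<le> r"
    have "R 1 t"
      unfolding R_def by (rule exI[of _ 1], rule exI[of _ 1]) auto
    then have "ev \<phi> t \<le> 1"
      by (rule dom)
    then have "ev \<phi> s \<le> 1"
      using le order_trans by blast
    also have "1 < ennreal (1 + 1 / real k)"
      using k by (subst ennreal_1[symmetric], subst ennreal_less_iff) auto
    finally show "ev \<phi> s < ennreal (1 + 1 / real k)" .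
  qed (use s in auto)
  then obtain M N where *: "0 < M" "of_nat N / of_nat M < ennreal (1 + 1 / real k)"
    "nmul M s' \<le> nmul N t"
    unfolding R_def by blast
  have "real N / real M < 1 + 1 / real k"
    using *(2) unfolding frac[OF *(1)] by (subst (asm) ennreal_less_iff) auto
  then have "real (N * k) \<le> real (M * Suc k)"
    using *(1) k by (simp add: field_simps)
  then have "N * k \<le> M * Suc k"
    by (simp only: of_nat_le_iff)
  then have "nmul (N * k) t \<le> nmul (M * Suc k) t"
    by (rule nmul_mono_left)
  moreover have "nmul (M * k) s' \<le> nmul (N * k) t"
    using nmul_mono[OF *(3), of k] by (simp add: nmul_nmul mult.commute)
  ultimately show thesis
    using that *(1) by (blast intro: order_trans)
qed

lemma O6_sum:
  assumes "finite J" "s \<le> (\<Sum>j\<in>J. t j)" "s' \<lless> (s::'a)"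
  obtains r where "s' \<le> (\<Sum>j\<in>J. r j)" "\<And>j. j \<in> J \<Longrightarrow> r j \<le> t j" "\<And>j. j \<in> J \<Longrightarrow> r j \<le> s"
proof -
  have "\<exists>r. s' \<le> (\<Sum>j\<in>J. r j) \<and> (\<forall>j\<in>J. r j \<le> t j \<and> r j \<le> s)"
    using assms
  proof (induction J arbitrary: s s' rule: finite_induct)
    case empty
    then show ?case
      using way_below_imp_le[of s' s] by auto
  next
    case (insert a J)
    \<comment> \<open>O6 delivers \<open>s'' \<le> r + u\<close>. Then
      \<open>s' \<lless> r + u\<close>, which leaves room to shrink \<open>u\<close> to some
      \<open>u' \<lless> u\<close> as the induction hypothesis demands.\<close>
    obtain s'' where s'': "s' \<lless> s''" "s'' \<lless> s"
      using interpolate[OF insert.prems(2)] .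
    have "s \<le> t a + (\<Sum>j\<in>J. t j)"
      using insert by simp
    then obtain r u where r: "s'' \<le> r + u" "r \<le> t a" "r \<le> s" "u \<le> (\<Sum>j\<in>J. t j)" "u \<le> s"
      using O6 s''(2) unfolding axiom_O6_def by blast
    obtain r' u' where u': "r' \<lless> r" "u' \<lless> u" "s' \<le> r' + u'"
      using way_below_addE[OF way_below_mono[OF order_refl s''(1) r(1)]] .
    obtain v where v: "u' \<le> (\<Sum>j\<in>J. v j)" "\<forall>j\<in>J. v j \<le> t j \<and> v j \<le> u"
      using insert.IH[OF r(4) u'(2)] by blast
    define w where "w = v(a := r')"
    have "(\<Sum>j\<in>insert a J. w j) = r' + (\<Sum>j\<in>J. v j)"
      using insert.hyps by (auto simp: w_def intro!: sum.cong arg_cong2[of _ _ _ _ "(+)"])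
    then have "s' \<le> (\<Sum>j\<in>insert a J. w j)"
      using u'(3) v(1) add_left_mono[of u' _ r'] by (metis order_trans)
    moreover have "\<forall>j\<in>insert a J. w j \<le> t j \<and> w j \<le> s"
      using v(2) r way_below_imp_le[OF u'(1)] by (auto simp: w_def intro: order_trans)
    ultimately show ?case by blast
  qed
  then show thesis using that by blast
qed

end

subsection \<open>The order structure of \<open>S_R\<close>\<close>

lemma sum_fun_apply: "(\<Sum>i\<in>I. f i) x = (\<Sum>i\<in>I. f i x :: 'b::comm_monoid_add)"
  by (induction I rule: infinite_finite_induct) auto

text \<open>The functions \<open>hat s / k\<close>. An equation of multiples avoids division in
  \<open>ennreal\<close>, and inequalities can be checked after multiplying by a common
  denominator.\<close>

definition basic :: "('a::ordered_semigroup functional \<Rightarrow> ennreal) set" where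
  "basic = {f. \<exists>s k. 0 < k \<and> (\<forall>\<phi>. of_nat k * f \<phi> = ev \<phi> s)}"

text \<open>A negative \<open>c\<close> gives the zero function, which spares sign conditions on
  real constants.\<close>

definition scl :: "real \<Rightarrow> ('b \<Rightarrow> ennreal) \<Rightarrow> 'b \<Rightarrow> ennreal" where
  "scl c f = (\<lambda>\<phi>. ennreal c * f \<phi>)"

lemma scl_apply [simp]: "scl c f \<phi> = ennreal c * f \<phi>"
  by (simp add: scl_def)

lemma of_nat_mult_cancel_ennreal:
  "0 < k \<Longrightarrow> of_nat k * a \<le> of_nat k * b \<longleftrightarrow> a \<le> (b::ennreal)"
  by (subst ennreal_mult_le_mult_iff) auto

lemma of_nat_mult_divide_ennreal: "0 < k \<Longrightarrow> of_nat k * (a / of_nat k) = (a::ennreal)"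
  using mult_divide_eq_ennreal[of "of_nat k" a] by (simp add: ennreal_times_divide mult.commute)

lemma inverse_of_nat_mult_ennreal: "0 < k \<Longrightarrow> of_nat k * (ennreal (1 / real k) * a) = a"
  by (simp add: ennreal_of_nat_eq_real_of_nat mult.assoc[symmetric] ennreal_mult'[symmetric])

lemma basicE:
  assumes "f \<in> basic"
  obtains s k where "0 < k" "\<And>\<phi>. of_nat k * f \<phi> = ev \<phi> s"
  using assms by (auto simp: basic_def)

lemma basicI: "0 < k \<Longrightarrow> (\<And>\<phi>. of_nat k * f \<phi> = ev \<phi> s) \<Longrightarrow> f \<in> basic"
  by (auto simp: basic_def)

lemma basic_frac: "0 < k \<Longrightarrow> (\<lambda>\<phi>. ennreal (1 / real k) * ev \<phi> s) \<in> basic"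
  by (rule basicI[of k _ s]) (auto simp: inverse_of_nat_mult_ennreal)

lemma basic_eq_frac:
  assumes "0 < k" "\<And>\<phi>. of_nat k * f \<phi> = ev \<phi> s"
  shows "f = (\<lambda>\<phi>. ennreal (1 / real k) * ev \<phi> s)"
  using assms inverse_of_nat_mult_ennreal[of k] by (auto simp: mult.left_commute simp flip: assms(2))

lemma basic_0: "0 \<in> basic"
  by (rule basicI[of 1 _ 0]) auto

lemma basic_add:
  assumes "f \<in> basic" "g \<in> basic" shows "f + g \<in> basic"
proof -
  obtain s k t l where *: "0 < k" "\<And>\<phi>. of_nat k * f \<phi> = ev \<phi> s" "0 < l" "\<And>\<phi>. of_nat l * g \<phi> = ev \<phi> t"
    using assms by (metis basicE)
  have eq: "of_nat (k * l) * (f + g) \<phi> = ev \<phi> (nmul l s + nmul k t)" for \<phi>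
    by (simp add: distrib_left mult_ac flip: *(2,4))
  show ?thesis
    by (rule basicI[OF _ eq]) (use * in simp)
qed

lemma basic_sum: "(\<And>i. i \<in> I \<Longrightarrow> f i \<in> basic) \<Longrightarrow> (\<Sum>i\<in>I. f i) \<in> basic"
  by (induction I rule: infinite_finite_induct) (auto intro: basic_0 basic_add)

lemma basic_scl:
  assumes "c \<in> \<rat>" "f \<in> basic" shows "scl c f \<in> basic"
proof (cases "c \<le> 0")
  case True
  then have "scl c f = 0" by (auto simp: ennreal_neg fun_eq_iff)
  then show ?thesis by (simp add: basic_0)
next
  case False
  then obtain a b where ab: "b \<noteq> 0" "c = real a / real b"
    using Rats_abs_nat_div_natE[OF assms(1)] by (metis abs_of_pos not_le)
  obtain s k where *: "0 < k" "\<And>\<phi>. of_nat k * f \<phi> = ev \<phi> s"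
    using assms by (metis basicE)
  have "(of_nat b :: ennreal) * ennreal c = of_nat a"
    using ab by (simp add: ennreal_of_nat_eq_real_of_nat flip: ennreal_mult')
  then have eq: "of_nat (k * b) * scl c f \<phi> = ev \<phi> (nmul a s)" for \<phi>
    by (simp add: mult_ac flip: *(2)) (metis mult.assoc mult.commute)
  show ?thesis
    by (rule basicI[OF _ eq]) (use * ab in simp)
qed

lemma basic_common_denominator:
  assumes "finite I" "\<And>i. i \<in> I \<Longrightarrow> f i \<in> basic"
  obtains s k where "0 < k" "\<And>i \<phi>. i \<in> I \<Longrightarrow> of_nat k * f i \<phi> = ev \<phi> (s i)"
proof -
  have "\<exists>s k. 0 < k \<and> (\<forall>i\<in>I. \<forall>\<phi>. of_nat k * f i \<phi> = ev \<phi> (s i))"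
    using assms
  proof (induction I rule: finite_induct)
    case (insert a I)
    then obtain s k where s: "0 < k" "\<And>i \<phi>. i \<in> I \<Longrightarrow> of_nat k * f i \<phi> = ev \<phi> (s i)"
      by (metis insertCI)
    obtain t l where t: "0 < l" "\<And>\<phi>. of_nat l * f a \<phi> = ev \<phi> t"
      using insert.prems by (metis basicE insertI1)
    define u where "u i = (if i = a then nmul k t else nmul l (s i))" for i
    have "of_nat (k * l) * f i \<phi> = ev \<phi> (u i)" if "i \<in> insert a I" for i \<phi>
      using that insert.hyps by (auto simp: u_def mult_ac simp flip: s(2) t(2))
    then show ?case
      using s(1) t(1) by (intro exI[of _ u] exI[of _ "k * l"]) auto
  qed (auto intro: exI[of _ 1])
  then show thesis using that by blast
qed

text \<open>
  The relation \<open>\<lless>\<close> of \<open>S_R\<close> in terms of that of \<open>S\<close>; see \<open>way_below_S_R_iff\<close>. The factor \<open>c\<close>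
  is what makes it work: \<open>\<lless>\<close> in \<open>S\<close> alone is not preserved by \<open>hat\<close>.
\<close>

definition wb :: "('a::ordered_semigroup functional \<Rightarrow> ennreal) \<Rightarrow> ('a functional \<Rightarrow> ennreal) \<Rightarrow> bool"
  where "wb x y \<longleftrightarrow> (\<exists>c s' s k. 1 < c \<and> 0 < k \<and> s' \<lless> s \<and>
    (\<forall>\<phi>. ennreal c * (of_nat k * x \<phi>) \<le> ev \<phi> s') \<and> (\<forall>\<phi>. ev \<phi> s \<le> of_nat k * y \<phi>))"

lemma wbE:
  assumes "wb x y"
  obtains c s' s k where "1 < c" "0 < k" "s' \<lless> s"
    "\<And>\<phi>. ennreal c * (of_nat k * x \<phi>) \<le> ev \<phi> s'" "\<And>\<phi>. ev \<phi> s \<le> of_nat k * y \<phi>"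
  using assms by (auto simp: wb_def)

lemma wbI:
  assumes "1 < c" "0 < k" "s' \<lless> s"
    "\<And>\<phi>. ennreal c * (of_nat k * x \<phi>) \<le> ev \<phi> s'" "\<And>\<phi>. ev \<phi> s \<le> of_nat k * y \<phi>"
  shows "wb x y"
  using assms unfolding wb_def by blast

lemma wb_mono:
  assumes "x' \<le> x" "wb x y" "y \<le> y'"
  shows "wb x' y'"
proof -
  obtain c s' s k where *: "1 < c" "0 < k" "s' \<lless> s"
    "\<And>\<phi>. ennreal c * (of_nat k * x \<phi>) \<le> ev \<phi> s'" "\<And>\<phi>. ev \<phi> s \<le> of_nat k * y \<phi>"
    by (rule wbE[OF assms(2)]) (rule that)
  have "ennreal c * (of_nat k * x' \<phi>) \<le> ev \<phi> s'" for \<phi>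
    by (rule order_trans[OF _ *(4)[of \<phi>]]) (use assms(1) in \<open>auto simp: le_fun_def intro!: mult_left_mono\<close>)
  moreover have "ev \<phi> s \<le> of_nat k * y' \<phi>" for \<phi>
    by (rule order_trans[OF *(5)[of \<phi>]]) (use assms(3) in \<open>auto simp: le_fun_def intro!: mult_left_mono\<close>)
  ultimately show ?thesis
    using *(1-3) by (rule wbI[rotated 3])
qed

lemma mult_ennreal_ge: "1 \<le> c \<Longrightarrow> a \<le> ennreal c * a"
  using mult_right_mono[of 1 "ennreal c" a] ennreal_leI[of 1 c] by simp

text \<open>The factor is split as \<open>sqrt c * sqrt c\<close>: one half goes to
  \<open>x\<close>, the other remains in the new witness.\<close>

lemma wb_scl_expand:
  assumes "wb x y" obtains c where "1 < c" "wb (scl c x) y"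
proof -
  obtain c s' s k where *: "1 < c" "0 < k" "s' \<lless> s"
    "\<And>\<phi>. ennreal c * (of_nat k * x \<phi>) \<le> ev \<phi> s'" "\<And>\<phi>. ev \<phi> s \<le> of_nat k * y \<phi>"
    by (rule wbE[OF assms]) (rule that)
  have "ennreal c = ennreal (sqrt c) * ennreal (sqrt c)"
    using *(1) by (simp flip: ennreal_mult')
  then have "wb (scl (sqrt c) x) y"
    using * by (intro wbI[of "sqrt c" k s' s]) (auto simp: mult_ac)
  then show thesis
    using that[of "sqrt c"] *(1) by simp
qed

lemma wb_imp_le:
  assumes "wb x y" shows "x \<le> y"
proof (rule le_funI)
  fix \<phi>
  obtain c s' s k where *: "1 < c" "0 < k" "s' \<lless> s"
    "\<And>\<phi>. ennreal c * (of_nat k * x \<phi>) \<le> ev \<phi> s'" "\<And>\<phi>. ev \<phi> s \<le> of_nat k * y \<phi>"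
    by (rule wbE[OF assms]) (rule that)
  have "of_nat k * x \<phi> \<le> ennreal c * (of_nat k * x \<phi>)"
    using *(1) by (intro mult_ennreal_ge) simp
  also have "\<dots> \<le> ev \<phi> s'" by (rule *)
  also have "\<dots> \<le> ev \<phi> s" using *(3) by (intro ev_mono way_below_imp_le)
  also have "\<dots> \<le> of_nat k * y \<phi>" by (rule *)
  finally show "x \<phi> \<le> y \<phi>"
    using *(2) by (simp add: of_nat_mult_cancel_ennreal)
qed

section \<open>Approximating sequences of functions \<open>hat s / k\<close>, and the relation
  \<lless> of \<open>S_R\<close>\<close>

definition approx_seq ::
  "(nat \<Rightarrow> 'a::ordered_semigroup functional \<Rightarrow> ennreal) \<Rightarrow> ('a functional \<Rightarrow> ennreal) \<Rightarrow> bool" where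
  "approx_seq Y f \<longleftrightarrow> (\<forall>i. Y i \<in> basic) \<and> (\<forall>i. wb (Y i) (Y (Suc i))) \<and> f = (SUP i. Y i)"

lemma approx_seqD:
  assumes "approx_seq Y f"
  shows "Y i \<in> basic" "wb (Y i) (Y (Suc i))" "f = (SUP i. Y i)" "incseq Y" "Y i \<le> f" "wb (Y i) f"
proof -
  show *: "Y i \<in> basic" "wb (Y i) (Y (Suc i))" "f = (SUP i. Y i)" for i
    using assms by (auto simp: approx_seq_def)
  show "incseq Y"
    by (intro incseq_SucI wb_imp_le *)
  show "Y i \<le> f" for i
    unfolding *(3) by (rule SUP_upper) simp
  then show "wb (Y i) f"
    using wb_mono[OF order_refl *(2)] by blast
qed

lemma SUP_basic_in_S_R:
  assumes inc: "incseq Y" and Y: "\<And>i. Y i \<in> basic"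
  shows "(SUP i. Y i) \<in> S_R"
proof -
  obtain s k where k: "\<And>i. 0 < k i" and s: "\<And>i \<phi>. of_nat (k i) * Y i \<phi> = ev \<phi> (s i)"
    using Y unfolding basic_def by simp metis
  have Yeq: "Y i \<phi> = hat (s i) \<phi> / of_nat (k i)" for i \<phi>
    using of_nat_mult_divide_ennreal[OF k[of i], of "Y i \<phi>"] by (simp add: hat_def ennreal_times_divide flip: s)
  have incp: "incseq (\<lambda>i. Y i \<phi>)" for \<phi>
    using inc by (auto simp: incseq_def le_fun_def)
  have add: "Y i (\<phi> + \<psi>) = Y i \<phi> + Y i \<psi>" for i \<phi> \<psi>
    by (simp add: Yeq hat_def plus_functional.rep_eq divide_ennreal_def distrib_right)
  have "(SUP i. Y i) \<in> Lsc"
    unfolding Lsc_def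
  proof (intro CollectI conjI allI impI)
    fix c
    have "{\<phi>. c < (SUP i. Y i) \<phi>} = (\<Union>i. {\<phi>. of_nat (k i) * c < ev \<phi> (s i)})"
    proof -
      have "c < Y i \<phi> \<longleftrightarrow> of_nat (k i) * c < ev \<phi> (s i)" for i \<phi>
        using of_nat_mult_cancel_ennreal[OF k, of i "Y i \<phi>" c] by (simp add: s not_le[symmetric])
      then show ?thesis by (auto simp: less_SUP_iff)
    qed
    then show "open {\<phi>. c < (SUP i. Y i) \<phi>}"
      by (simp add: open_ev_greater open_UN)
  next
    fix \<phi> \<psi>
    show "(SUP i. Y i) (\<phi> + \<psi>) = (SUP i. Y i) \<phi> + (SUP i. Y i) \<psi>"
      using ennreal_SUP_add[OF incp incp, of \<phi> \<psi>] by (simp add: add image_image)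
  next
    fix r :: real and \<phi> assume "0 < r"
    have "Y i (scale_functional r \<phi>) = ennreal r * Y i \<phi>" for i
      by (simp add: Yeq hat_def scale_functional.rep_eq divide_ennreal_def mult.assoc)
    then show "(SUP i. Y i) (scale_functional r \<phi>) = ennreal r * (SUP i. Y i) \<phi>"
      by (simp add: SUP_mult_left_ennreal image_image)
  next
    have "Y i 0 = 0" for i
      by (simp add: Yeq hat_def zero_functional.rep_eq)
    then show "(SUP i. Y i) 0 = 0" by (simp add: image_image)
  qed
  moreover have "incseq (\<lambda>i \<phi>. hat (s i) \<phi> / of_nat (k i))"
    using inc by (simp flip: Yeq)
  ultimately show ?thesis
    unfolding S_R_def using k Yeq by (auto intro!: exI[of _ s] exI[of _ k] simp: image_image)
qed

lemma S_R_E: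
  assumes "f \<in> S_R"
  obtains Y where "incseq Y" "\<And>i. Y i \<in> basic" "f = (SUP i. Y i)"
proof -
  obtain s k where *: "\<And>i. 0 < k i" "incseq (\<lambda>i \<phi>. hat (s i) \<phi> / of_nat (k i))"
    "\<And>\<phi>. f \<phi> = (SUP i. hat (s i) \<phi> / of_nat (k i))"
    using assms unfolding S_R_def by blast
  have "(\<lambda>\<phi>. hat (s i) \<phi> / of_nat (k i)) \<in> basic" for i
    using *(1)[of i] by (intro basicI[of "k i" _ "s i"])
      (auto simp: hat_def of_nat_mult_divide_ennreal)
  with * show thesis
    by (intro that[of "\<lambda>i \<phi>. hat (s i) \<phi> / of_nat (k i)"]) (auto simp: fun_eq_iff image_image)
qed

lemma basic_in_S_R:
  assumes "f \<in> basic" shows "f \<in> S_R"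
  using SUP_basic_in_S_R[of "\<lambda>_. f"] assms by simp

context Cu_semigroup
begin

lemma wb_add:
  assumes "wb x (y :: 'a functional \<Rightarrow> ennreal)" "wb x' y'"
  shows "wb (x + x') (y + y')"
proof -
  obtain c s' s k where *: "1 < c" "0 < k" "s' \<lless> s"
    "\<And>\<phi>. ennreal c * (of_nat k * x \<phi>) \<le> ev \<phi> s'" "\<And>\<phi>. ev \<phi> s \<le> of_nat k * y \<phi>"
    by (rule wbE[OF assms(1)]) (rule that)
  obtain d t' t l where **: "1 < d" "0 < l" "t' \<lless> t"
    "\<And>\<phi>. ennreal d * (of_nat l * x' \<phi>) \<le> ev \<phi> t'" "\<And>\<phi>. ev \<phi> t \<le> of_nat l * y' \<phi>"
    by (rule wbE[OF assms(2)]) (rule that)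
  show ?thesis
  proof (rule wbI)
    show "1 < min c d" "0 < k * l" "nmul l s' + nmul k t' \<lless> nmul l s + nmul k t"
      using * ** by (auto intro: way_below_add way_below_nmul)
    fix \<phi>
    have "ennreal (min c d) * (of_nat (k * l) * (x + x') \<phi>)
        = of_nat l * (ennreal (min c d) * (of_nat k * x \<phi>)) + of_nat k * (ennreal (min c d) * (of_nat l * x' \<phi>))"
      by (simp add: algebra_simps)
    also have "\<dots> \<le> of_nat l * (ennreal c * (of_nat k * x \<phi>)) + of_nat k * (ennreal d * (of_nat l * x' \<phi>))"
      by (intro add_mono mult_left_mono mult_right_mono ennreal_leI) auto
    also have "\<dots> \<le> of_nat l * ev \<phi> s' + of_nat k * ev \<phi> t'"
      by (intro add_mono mult_left_mono * **) auto
    finally show "ennreal (min c d) * (of_nat (k * l) * (x + x') \<phi>) \<le> ev \<phi> (nmul l s' + nmul k t')"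
      by simp
    have "of_nat l * ev \<phi> s + of_nat k * ev \<phi> t \<le> of_nat l * (of_nat k * y \<phi>) + of_nat k * (of_nat l * y' \<phi>)"
      by (intro add_mono mult_left_mono * **) auto
    then show "ev \<phi> (nmul l s + nmul k t) \<le> of_nat (k * l) * (y + y') \<phi>"
      by (simp add: algebra_simps)
  qed
qed

lemma wb_0: "wb 0 (y :: 'a functional \<Rightarrow> ennreal)"
  by (rule wbI[of 2 1 0 0]) (auto simp: way_below_zero)

lemma wb_sum:
  "(\<And>i. i \<in> I \<Longrightarrow> wb (x i) (y i :: 'a functional \<Rightarrow> ennreal)) \<Longrightarrow> wb (\<Sum>i\<in>I. x i) (\<Sum>i\<in>I. y i)"
  by (induction I rule: infinite_finite_induct) (auto intro: wb_0 wb_add)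

lemma wb_scl:
  assumes "wb x (y :: 'a functional \<Rightarrow> ennreal)" "r \<in> \<rat>"
  shows "wb (scl r x) (scl r y)"
proof (cases "r \<le> 0")
  case True
  then have "scl r x = 0" by (auto simp: ennreal_neg fun_eq_iff)
  then show ?thesis by (simp add: wb_0)
next
  case False
  then obtain a b where ab: "b \<noteq> 0" "r = real a / real b"
    using Rats_abs_nat_div_natE[OF assms(2)] by (metis abs_of_pos not_le)
  obtain c s' s k where *: "1 < c" "0 < k" "s' \<lless> s"
    "\<And>\<phi>. ennreal c * (of_nat k * x \<phi>) \<le> ev \<phi> s'" "\<And>\<phi>. ev \<phi> s \<le> of_nat k * y \<phi>"
    by (rule wbE[OF assms(1)]) (rule that)
  have br: "(of_nat b :: ennreal) * (ennreal r * z) = of_nat a * z" for z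
    using ab by (simp add: ennreal_of_nat_eq_real_of_nat mult.assoc[symmetric] flip: ennreal_mult')
  show ?thesis
  proof (rule wbI)
    show "1 < c" "0 < k * b" "nmul a s' \<lless> nmul a s"
      using * ab by (auto intro: way_below_nmul)
    fix \<phi>
    have "ennreal c * (of_nat (k * b) * scl r x \<phi>) = ennreal c * (of_nat k * (of_nat b * (ennreal r * x \<phi>)))"
      by (simp add: mult.assoc)
    also have "\<dots> = of_nat a * (ennreal c * (of_nat k * x \<phi>))"
      unfolding br by (simp add: mult_ac)
    also have "\<dots> \<le> of_nat a * ev \<phi> s'"
      by (intro mult_left_mono *) auto
    finally show "ennreal c * (of_nat (k * b) * scl r x \<phi>) \<le> ev \<phi> (nmul a s')"
      by simp
    have "of_nat (k * b) * scl r y \<phi> = of_nat k * (of_nat b * (ennreal r * y \<phi>))"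
      by (simp add: mult.assoc)
    also have "\<dots> = of_nat a * (of_nat k * y \<phi>)"
      unfolding br by (simp add: mult_ac)
    finally show "ev \<phi> (nmul a s) \<le> of_nat (k * b) * scl r y \<phi>"
      using mult_left_mono[OF *(5)[of \<phi>], of "of_nat a"] by simp
  qed
qed

text \<open>The factor \<open>c\<close> built into \<open>wb\<close> is exactly what
  \<open>hat_le_SUP_imp\<close> loses, so the two cancel.\<close>

lemma wb_le_SUP:
  assumes wb: "wb x (y :: 'a functional \<Rightarrow> ennreal)" and Y: "incseq Y" "\<And>i. Y i \<in> basic" "y \<le> (SUP i. Y i)"
  shows "\<exists>i. x \<le> Y i"
proof -
  obtain c s' s k where *: "1 < c" "0 < k" "s' \<lless> s"
    "\<And>\<phi>. ennreal c * (of_nat k * x \<phi>) \<le> ev \<phi> s'" "\<And>\<phi>. ev \<phi> s \<le> of_nat k * y \<phi>"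
    by (rule wbE[OF wb]) (rule that)
  define G where "G i \<phi> = of_nat k * Y i \<phi>" for i \<phi>
  obtain i where i: "\<And>\<phi>. ev \<phi> s' \<le> ennreal c * G i \<phi>"
  proof (rule hat_le_SUP_imp[of G s "ennreal c" s'])
    show "incseq G"
      using Y(1) by (auto simp: G_def incseq_def le_fun_def intro: mult_left_mono)
    show "ev \<phi> s \<le> (SUP i. G i \<phi>)" for \<phi>
      unfolding G_def SUP_mult_left_ennreal[symmetric]
      by (rule order_trans[OF *(5)]) (use Y(3) in \<open>auto simp: le_fun_def image_image intro!: mult_left_mono\<close>)
    show "\<exists>t l. 0 < l \<and> (\<forall>\<phi>. of_nat l * G i \<phi> = ev \<phi> t)" for i
    proof -
      obtain t l where "0 < l" "\<And>\<phi>. of_nat l * Y i \<phi> = ev \<phi> t"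
        using Y(2) by (metis basicE)
      then show ?thesis
        by (intro exI[of _ "nmul k t"] exI[of _ l]) (auto simp: G_def mult_ac)
    qed
    show "1 < ennreal c"
      using *(1) by (subst ennreal_1[symmetric], subst ennreal_less_iff) auto
  qed (use * in auto)
  have "x \<le> Y i"
  proof (rule le_funI)
    fix \<phi>
    have "ennreal c * (of_nat k * x \<phi>) \<le> ennreal c * (of_nat k * Y i \<phi>)"
      using order_trans[OF *(4) i] by (simp add: G_def)
    then show "x \<phi> \<le> Y i \<phi>"
      using *(1,2) by (subst (asm) ennreal_mult_le_mult_iff) (auto simp: of_nat_mult_cancel_ennreal)
  qed
  then show ?thesis by blast
qed

text \<open>The witness inside \<open>wb x y\<close> may be unrelated to the given representation of
  \<open>y\<close>. Comparison with an approximating sequence of \<open>s\<close> gives one below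
  \<open>s\<close> with the given denominator.\<close>

lemma wb_hatE:
  assumes wb: "wb x (y :: 'a functional \<Rightarrow> ennreal)" and k: "0 < k" and y: "\<And>\<phi>. of_nat k * y \<phi> = ev \<phi> s"
  obtains s' where "s' \<lless> s" "\<And>\<phi>. of_nat k * x \<phi> \<le> ev \<phi> s'"
proof -
  obtain T where T: "incseq T" "\<And>n. T n \<lless> T (Suc n)" "isLub UNIV (range T) s" "\<And>n. T n \<lless> s"
    using approximating_sequence[of s] by blast
  define Y where "Y i = (\<lambda>\<phi>. ennreal (1 / real k) * ev \<phi> (T i))" for i
  have "\<exists>i. x \<le> Y i"
  proof (rule wb_le_SUP[OF wb])
    show "incseq Y"
      using T(1) by (auto simp: Y_def incseq_def le_fun_def intro!: mult_left_mono ev_mono)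
    show "Y i \<in> basic" for i
      unfolding Y_def by (rule basic_frac[OF k])
    show "y \<le> (SUP i. Y i)"
      unfolding basic_eq_frac[OF k y] Y_def
      by (simp add: le_fun_def ev_lub[OF T(1,3)] SUP_mult_left_ennreal image_image)
  qed
  then obtain i where i: "x \<le> Y i" ..
  have "of_nat k * x \<phi> \<le> of_nat k * Y i \<phi>" for \<phi>
    using i by (intro mult_left_mono) (auto simp: le_fun_def)
  then show thesis
    using that[OF T(4)[of i]] inverse_of_nat_mult_ennreal[OF k] by (simp add: Y_def)
qed

lemma basic_approx:
  assumes "f \<in> basic" obtains Y where "approx_seq Y (f :: 'a functional \<Rightarrow> ennreal)"
proof -
  obtain s k where k: "0 < k" "\<And>\<phi>. of_nat k * f \<phi> = ev \<phi> s"
    using assms by (metis basicE)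
  obtain T where T: "incseq T" "\<And>n. T n \<lless> T (Suc n)" "isLub UNIV (range T) s" "\<And>n. T n \<lless> s"
    using approximating_sequence[of s] by blast
  define Z where "Z i = (\<lambda>\<phi>. ennreal (1 / real k) * ev \<phi> (T i))" for i
  \<comment> \<open>\<open>T i \<lless> T (Suc i)\<close> alone does not give \<open>wb\<close>; the
    strictly increasing rational factors supply \<open>r (Suc i) / r i > 1\<close>. The 2 makes
    \<open>r 0\<close> positive.\<close>
  define r where "r i = 1 - 1 / (real i + 2)" for i :: nat
  have rQ: "r i \<in> \<rat>" for i
    by (auto simp: r_def)
  have r_less: "0 < r i" "r i < r (Suc i)" for i
    by (auto simp: r_def field_simps)
  define Y where "Y i = scl (r i) (Z i)" for i
  have Zk: "of_nat k * Z i \<phi> = ev \<phi> (T i)" for i \<phi>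
    unfolding Z_def using inverse_of_nat_mult_ennreal[OF k(1)] by simp
  have basic: "Y i \<in> basic" for i
    unfolding Y_def Z_def by (intro basic_scl rQ basic_frac k)
  have wb: "wb (Y i) (Y (Suc i))" for i
  proof -
    have "wb (scl (r i / r (Suc i)) (Z i)) (Z (Suc i))"
    proof (rule wbI)
      show "1 < r (Suc i) / r i" "0 < k" "T i \<lless> T (Suc i)"
        using r_less[of i] k T by auto
      have "ennreal (r (Suc i) / r i) * ennreal (r i / r (Suc i)) = 1"
        using r_less[of i] r_less[of "Suc i"] by (simp flip: ennreal_mult')
      then have "ennreal (r (Suc i) / r i) * (ennreal (r i / r (Suc i)) * a) = a" for a
        by (simp add: mult.assoc[symmetric])
      then show "ennreal (r (Suc i) / r i) * (of_nat k * scl (r i / r (Suc i)) (Z i) \<phi>) \<le> ev \<phi> (T i)" for \<phi>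
        by (simp add: mult.left_commute[of "of_nat k"] Zk)
    qed (simp add: Zk)
    from wb_scl[OF this rQ[of "Suc i"]]
    show ?thesis
      using r_less[of i] r_less[of "Suc i"]
      by (simp add: Y_def scl_def mult.assoc[symmetric] flip: ennreal_mult')
  qed
  have "f \<phi> = (SUP i. Y i \<phi>)" for \<phi>
  proof (rule LIMSEQ_unique)
    have inc: "incseq Y"
      using wb by (intro incseq_SucI wb_imp_le)
    then show "(\<lambda>i. Y i \<phi>) \<longlonglongrightarrow> (SUP i. Y i \<phi>)"
      by (intro LIMSEQ_SUP) (auto simp: incseq_def le_fun_def)
    have "incseq (\<lambda>i. Z i \<phi>)"
      using T(1) by (auto simp: Z_def incseq_def intro!: mult_left_mono ev_mono)
    then have "(\<lambda>i. Z i \<phi>) \<longlonglongrightarrow> (SUP i. Z i \<phi>)"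
      by (rule LIMSEQ_SUP)
    also have "(SUP i. Z i \<phi>) = f \<phi>"
      unfolding basic_eq_frac[OF k] Z_def by (simp add: ev_lub[OF T(1,3)] SUP_mult_left_ennreal)
    finally have Z: "(\<lambda>i. Z i \<phi>) \<longlonglongrightarrow> f \<phi>" .
    have "r \<longlonglongrightarrow> 1"
      unfolding r_def by real_asymp
    then have "(\<lambda>i. ennreal (r i)) \<longlonglongrightarrow> ennreal 1"
      by (rule tendsto_ennrealI)
    then have "(\<lambda>i. ennreal (r i) * Z i \<phi>) \<longlonglongrightarrow> ennreal 1 * f \<phi>"
      by (intro tendsto_mult_ennreal Z) auto
    then show "(\<lambda>i. Y i \<phi>) \<longlonglongrightarrow> f \<phi>"
      by (simp add: Y_def)
  qed
  then have "approx_seq Y f"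
    using basic wb by (auto simp: approx_seq_def fun_eq_iff image_image)
  then show thesis by (rule that)
qed

text \<open>The \<open>n\<close>-th term is taken from row \<open>n\<close>, hence lies below
  \<open>T n\<close>, but above \<open>Y m n\<close> for all \<open>m \<le> n\<close>, so nothing is
  lost in the supremum. Each choice meets finitely many conditions, every one by
  \<open>wb_le_SUP\<close>.\<close>

lemma diagonal_approx:
  assumes Y: "\<And>n. approx_seq (Y n) (T n :: 'a functional \<Rightarrow> ennreal)" and T: "incseq T"
  obtains d where "approx_seq d (SUP n. T n)" "\<And>n. d n \<le> T n"
proof -
  define P where "P n x \<longleftrightarrow> (\<exists>i. x = Y n i) \<and> (\<forall>m\<le>n. Y m n \<le> x)" for n x
  have ex: "\<exists>i. x \<le> Y n i" if "wb x (T m)" "m \<le> n" for x m n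
    using that wb_mono[OF order_refl _ incseqD[OF T], of x m n]
    by (intro wb_le_SUP[where y = "T n"] approx_seqD[OF Y] eq_refl) auto
  have step: "\<exists>i. \<forall>x\<in>F. x \<le> Y n i" if "finite F" "\<And>x. x \<in> F \<Longrightarrow> \<exists>m\<le>n. wb x (T m)" for F n
    using that
  proof (induction F rule: finite_induct)
    case (insert a F)
    then obtain i where i: "\<forall>x\<in>F. x \<le> Y n i"
      by blast
    obtain j where j: "a \<le> Y n j"
      using insert.prems ex by blast
    have "Y n i \<le> Y n (max i j)" "Y n j \<le> Y n (max i j)"
      using incseqD[OF approx_seqD(4)[OF Y]] by auto
    then show ?case
      using i j order_trans by blast
  qed simp
  have "\<exists>d. \<forall>n. P n (d n) \<and> wb (d n) (d (Suc n))"
  proof (rule dependent_nat_choice)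
    show "\<exists>x. P 0 x"
      by (auto simp: P_def)
  next
    fix x n assume "P n x"
    then obtain i where x: "x = Y n i"
      by (auto simp: P_def)
    define F where "F = insert x ((\<lambda>m. Y m (Suc n)) ` {..Suc n})"
    have "\<exists>i. \<forall>z\<in>F. z \<le> Y (Suc n) i"
    proof (rule step)
      fix z assume "z \<in> F"
      then consider "z = Y n i" | m where "m \<le> Suc n" "z = Y m (Suc n)"
        by (auto simp: F_def x)
      then show "\<exists>m\<le>Suc n. wb z (T m)"
      proof cases
        case 1
        then show ?thesis using approx_seqD(6)[OF Y] by (intro exI[of _ n]) simp
      next
        case 2
        then show ?thesis using approx_seqD(6)[OF Y] by (intro exI[of _ m]) simp
      qed
    qed (simp add: F_def)
    then obtain i where i: "\<And>z. z \<in> F \<Longrightarrow> z \<le> Y (Suc n) i" by blast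
    \<comment> \<open>One index beyond \<open>i\<close> turns the bound on \<open>x\<close> into
      \<open>wb\<close>.\<close>
    have up: "Y (Suc n) i \<le> Y (Suc n) (Suc i)"
      using incseqD[OF approx_seqD(4)[OF Y]] by simp
    have "P (Suc n) (Y (Suc n) (Suc i))"
      unfolding P_def using i up by (auto simp: F_def intro: order_trans)
    moreover have "wb x (Y (Suc n) (Suc i))"
      using wb_mono[OF i approx_seqD(2)[OF Y] order_refl] by (simp add: F_def)
    ultimately show "\<exists>y. P (Suc n) y \<and> wb x y" by blast
  qed
  then obtain d where d: "\<And>n. P n (d n)" "\<And>n. wb (d n) (d (Suc n))"
    by blast
  have le: "d n \<le> T n" for n
    using d(1)[of n] approx_seqD(5)[OF Y] by (auto simp: P_def)
  have "(SUP n. T n) = (SUP n. d n)"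
  proof (rule antisym)
    show "(SUP n. d n) \<le> (SUP n. T n)"
      using le by (intro SUP_mono) blast
    have "Y m i \<le> (SUP n. d n)" for m i
    proof -
      have "Y m i \<le> Y m (max m i)"
        using incseqD[OF approx_seqD(4)[OF Y]] by simp
      also have "\<dots> \<le> d (max m i)"
        using d(1)[of "max m i"] by (simp add: P_def)
      also have "\<dots> \<le> (SUP n. d n)"
        by (rule SUP_upper) simp
      finally show ?thesis .
    qed
    then show "(SUP n. T n) \<le> (SUP n. d n)"
      using approx_seqD(3)[OF Y] by (intro SUP_least) (metis SUP_least)
  qed
  moreover have "d n \<in> basic" for n
    using d(1)[of n] approx_seqD(1)[OF Y] by (auto simp: P_def)
  ultimately have "approx_seq d (SUP n. T n)"
    using d(2) by (simp add: approx_seq_def)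
  then show thesis
    using that le by blast
qed

lemma S_R_approx:
  assumes "f \<in> S_R" obtains Y where "approx_seq Y (f :: 'a functional \<Rightarrow> ennreal)"
proof -
  obtain T where T: "incseq T" "\<And>i. T i \<in> basic" "f = (SUP i. T i)"
    by (rule S_R_E[OF assms]) (rule that)
  have "\<exists>Y. \<forall>n. approx_seq (Y n) (T n)"
    by (rule choice) (use basic_approx[OF T(2)] in blast)
  then obtain Y where Y: "\<And>n. approx_seq (Y n) (T n)"
    by blast
  show thesis
    using diagonal_approx[OF Y T(1)] that T(3) by metis
qed

lemma approx_in_S_R: "approx_seq Y (f :: 'a functional \<Rightarrow> ennreal) \<Longrightarrow> f \<in> S_R"
  using SUP_basic_in_S_R[of Y] approx_seqD[of Y f] by simp

lemma S_R_diagonal: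
  assumes "incseq T" "\<And>n. T n \<in> S_R"
  obtains d where "approx_seq d (SUP n. T n :: 'a functional \<Rightarrow> ennreal)" "\<And>n. d n \<le> T n"
proof -
  have "\<exists>Y. \<forall>n. approx_seq (Y n) (T n)"
    by (rule choice) (use S_R_approx[OF assms(2)] in blast)
  then obtain Y where Y: "\<And>n. approx_seq (Y n) (T n)"
    by blast
  show thesis
    using diagonal_approx[OF Y assms(1)] that by blast
qed

text \<open>The pointwise supremum of an increasing sequence in \<open>S_R\<close> is itself in
  \<open>S_R\<close>, so it is also the supremum taken inside \<open>S_R\<close>.\<close>

lemma isLub_S_R:
  assumes T: "incseq T" "range T \<subseteq> S_R" and u: "isLub S_R (range T) (u :: 'a functional \<Rightarrow> ennreal)"
  shows "u = (SUP n. T n)"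
proof -
  obtain d where "approx_seq d (SUP n. T n)"
    using S_R_diagonal[OF T(1)] T(2) by blast
  then have "(SUP n. T n) \<in> S_R"
    by (rule approx_in_S_R)
  then have "isUb S_R (range T) (SUP n. T n)"
    by (auto simp: isUb_def setle_def intro: SUP_upper)
  then have "u \<le> (SUP n. T n)"
    using u by (auto simp: isLub_def leastP_def setge_def)
  moreover have "(SUP n. T n) \<le> u"
    using u by (intro SUP_least) (auto dest: isLubD2)
  ultimately show ?thesis by simp
qed

text \<open>One direction tests \<open>way_below\<close> on an approximating sequence of
  \<open>y\<close>. In the other, an arbitrary sequence in \<open>S_R\<close> is replaced by a
  diagonal sequence in \<open>basic\<close> below it, to which \<open>wb_le_SUP\<close>
  applies.\<close>

lemma way_below_S_R_iff:
  "way_below S_R x (y :: 'a functional \<Rightarrow> ennreal) \<longleftrightarrow> x \<in> S_R \<and> y \<in> S_R \<and> wb x y"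
proof (intro iffI conjI; (elim conjE)?)
  assume xy: "way_below S_R x y"
  then show "x \<in> S_R" and y: "y \<in> S_R"
    by (auto simp: way_below_def)
  obtain Y where Y: "approx_seq Y y"
    using S_R_approx[OF y] .
  have "isLub S_R (range Y) y"
    using y approx_seqD(3,5)[OF Y]
    by (auto simp: isLub_def leastP_def isUb_def setle_def setge_def intro: SUP_least)
  moreover have "range Y \<subseteq> S_R"
    using basic_in_S_R approx_seqD(1)[OF Y] by blast
  ultimately obtain n where "x \<le> Y n"
    using xy approx_seqD(4)[OF Y] unfolding way_below_def by blast
  then show "wb x y"
    using wb_mono approx_seqD(6)[OF Y] by blast
next
  assume "x \<in> S_R" "y \<in> S_R" and xy: "wb x y"
  then show "way_below S_R x y"
    unfolding way_below_def
  proof (intro conjI allI impI; (elim conjE)?)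
    fix T u assume T: "incseq T" "range T \<subseteq> S_R" "isLub S_R (range T) u" "y \<le> u"
    obtain d where d: "approx_seq d (SUP n. T n)" "\<And>n. d n \<le> T n"
      using S_R_diagonal[OF T(1)] T(2) by blast
    have "y \<le> (SUP n. d n)"
      using T(4) isLub_S_R[OF T(1-3)] approx_seqD(3)[OF d(1)] by simp
    then obtain n where "x \<le> d n"
      using wb_le_SUP[OF xy approx_seqD(4)[OF d(1)] approx_seqD(1)[OF d(1)]] by blast
    then show "\<exists>n. x \<le> T n"
      using d(2) order_trans by blast
  qed auto
qed

text \<open>The approximating sequences of all \<open>y j\<close> are run with the same index; their
  sums increase to the sum of the \<open>y j\<close>.\<close>

lemma wb_sumE:
  assumes J: "finite J" and y: "\<And>j. j \<in> J \<Longrightarrow> y j \<in> S_R"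
    and wb: "wb x (\<Sum>j\<in>J. y j :: 'a functional \<Rightarrow> ennreal)"
  obtains z where "\<And>j. j \<in> J \<Longrightarrow> z j \<in> basic" "\<And>j. j \<in> J \<Longrightarrow> wb (z j) (y j)" "x \<le> (\<Sum>j\<in>J. z j)"
proof -
  have "\<exists>Y. \<forall>j\<in>J. approx_seq (Y j) (y j)"
    by (rule bchoice) (use S_R_approx[OF y] in blast)
  then obtain Y where Y: "\<And>j. j \<in> J \<Longrightarrow> approx_seq (Y j) (y j)"
    by blast
  have "\<exists>i. x \<le> (\<Sum>j\<in>J. Y j i)"
  proof (rule wb_le_SUP[OF wb])
    show "incseq (\<lambda>i. \<Sum>j\<in>J. Y j i)"
      using incseqD[OF approx_seqD(4)[OF Y]] by (auto simp: incseq_def intro!: sum_mono)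
    show "(\<Sum>j\<in>J. Y j i) \<in> basic" for i
      by (intro basic_sum approx_seqD(1)[OF Y])
    have "(\<Sum>j\<in>J. y j) \<phi> = (SUP i. (\<Sum>j\<in>J. Y j i) \<phi>)" for \<phi>
    proof -
      have "(SUP i. \<Sum>j\<in>J. Y j i \<phi>) = (\<Sum>j\<in>J. SUP i. Y j i \<phi>)"
        by (intro ennreal_SUP_sum) (use approx_seqD(4)[OF Y] in \<open>auto simp: incseq_def le_fun_def\<close>)
      also have "\<dots> = (\<Sum>j\<in>J. y j \<phi>)"
        by (intro sum.cong refl) (simp add: approx_seqD(3)[OF Y] image_image)
      finally show ?thesis by (simp add: sum_fun_apply)
    qed
    then show "(\<Sum>j\<in>J. y j) \<le> (SUP i. \<Sum>j\<in>J. Y j i)"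
      by (simp add: le_fun_def image_image)
  qed
  then obtain i where "x \<le> (\<Sum>j\<in>J. Y j i)" ..
  then show thesis
    by (intro that[of "\<lambda>j. Y j i"]) (auto intro: approx_seqD[OF Y])
qed

lemma wb_interpolate:
  assumes "wb x y" "(y :: 'a functional \<Rightarrow> ennreal) \<in> S_R"
  obtains z where "z \<in> basic" "wb x z" "wb z y"
proof -
  obtain Y where Y: "approx_seq Y y"
    using S_R_approx[OF assms(2)] .
  obtain i where "x \<le> Y i"
    using wb_le_SUP[OF assms(1) approx_seqD(4,1)[OF Y]] approx_seqD(3)[OF Y] by auto
  then show thesis
    using that approx_seqD[OF Y] wb_mono[OF _ approx_seqD(2)[OF Y] order_refl] by blast
qed

end

subsection \<open>Decomposition of basic functions\<close>

lemma scl_mono: "x \<le> y \<Longrightarrow> scl c x \<le> scl c y"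
  by (auto simp: le_fun_def intro: mult_left_mono)

lemma scl_mono_left: "c \<le> d \<Longrightarrow> scl c x \<le> scl d x"
  by (auto simp: le_fun_def intro!: mult_right_mono ennreal_leI)

lemma scl_scl: "0 \<le> a \<Longrightarrow> scl a (scl b x) = scl (a * b) x"
  by (auto simp: fun_eq_iff ennreal_mult' mult.assoc)

lemma scl_one [simp]: "scl 1 x = x"
  by (simp add: fun_eq_iff)

lemma sum_scl_apply: "(\<Sum>i\<in>I. scl c (f i)) \<phi> = ennreal c * (\<Sum>i\<in>I. f i) \<phi>"
  by (simp add: sum_fun_apply sum_distrib_left)

lemma sum_singleton_Times: "(\<Sum>p\<in>{i} \<times> J. F p) = (\<Sum>j\<in>J. F (i, j))"
proof -
  have "{i} \<times> J = Pair i ` J" by auto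
  then show ?thesis by (simp add: sum.reindex inj_on_def)
qed

lemma sum_Times_singleton: "(\<Sum>p\<in>I \<times> {j}. F p) = (\<Sum>i\<in>I. F (i, j))"
proof -
  have "I \<times> {j} = (\<lambda>i. (i, j)) ` I" by auto
  then show ?thesis by (simp add: sum.reindex inj_on_def)
qed

text \<open>For infinite \<open>g\<close> the summand \<open>e * g\<close> makes the second bound
  infinite. For finite \<open>g\<close> the error \<open>e^2\<close> is small enough because
  \<open>(1 - e) * (1 - e^2) + (1 + e) * e = 1 + e^3\<close>.\<close>

lemma cut_rescale:
  fixes y z g :: ennreal
  assumes e: "0 < e" "e < 1" and le: "y + z \<le> g" and ge: "g \<le> y + z + ennreal (e\<^sup>2) * g"
  shows "ennreal (1 - e) * y + (ennreal (1 - e) * z + ennreal e * g) \<le> g" (is ?A)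
    and "g \<le> ennreal (1 - e) * y + ennreal (1 + e) * (ennreal (1 - e) * z + ennreal e * g)" (is ?B)
proof -
  have "?A \<and> ?B"
  proof (cases "g = top")
    case True
    then show ?thesis
      using e by (simp add: ennreal_mult_top)
  next
    case False
    then have "y \<noteq> top" "z \<noteq> top"
      using le by (auto simp: top_unique)
    then obtain g' y' z' where r: "g = ennreal g'" "y = ennreal y'" "z = ennreal z'"
      "0 \<le> g'" "0 \<le> y'" "0 \<le> z'"
      using False by (metis ennreal_cases)
    have le': "y' + z' \<le> g'"
      using le r by (simp flip: ennreal_plus)
    have ge': "g' \<le> y' + z' + e\<^sup>2 * g'"
      using ge r by (simp flip: ennreal_plus ennreal_mult)
    have A: "(1 - e) * y' + ((1 - e) * z' + e * g') \<le> g'"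
      using mult_left_mono[OF le', of "1 - e"] e by (simp add: algebra_simps)
    have B: "g' \<le> (1 - e) * y' + (1 + e) * ((1 - e) * z' + e * g')"
    proof -
      have "(1 - e) * (g' - e\<^sup>2 * g') \<le> (1 - e) * (y' + z')"
        using ge' e by (intro mult_left_mono) auto
      then have "g' + e ^ 3 * g' - e * g' - e\<^sup>2 * g' \<le> (1 - e) * y' + (1 - e) * z'"
        by (simp add: algebra_simps power2_eq_square power3_eq_cube)
      moreover have "0 \<le> e ^ 3 * g'" "0 \<le> e * ((1 - e) * z')"
        using e r by simp_all
      ultimately show ?thesis
        by (simp add: algebra_simps power2_eq_square)
    qed
    show ?thesis
      using A B r e by (simp flip: ennreal_plus ennreal_mult add: mult_nonneg_nonneg)
  qed
  then show ?A ?B by auto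
qed

context Cu_semigroup
begin

text \<open>Taking \<open>k = 1\<close> in \<open>hat_le_imp_nmul_le\<close> loses a factor 2,
  whence \<open>scl 2 (g j)\<close>. O6 then splits \<open>nmul M s1\<close> in \<open>S\<close>,
  and the pieces are divided by \<open>L * M\<close>. A fixed loss is acceptable, as the constant is
  improved later.\<close>

lemma O6_basic:
  fixes f f' :: "'a functional \<Rightarrow> ennreal" and g :: "'j \<Rightarrow> 'a functional \<Rightarrow> ennreal"
  assumes J: "finite J" and f: "f \<in> basic" and g: "\<And>j. j \<in> J \<Longrightarrow> g j \<in> basic"
    and le: "f \<le> (\<Sum>j\<in>J. g j)" and wb: "wb f' f"
  obtains a where "\<And>j. j \<in> J \<Longrightarrow> a j \<in> basic" "f' \<le> (\<Sum>j\<in>J. a j)"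
    "\<And>j. j \<in> J \<Longrightarrow> a j \<le> f" "\<And>j. j \<in> J \<Longrightarrow> a j \<le> scl 2 (g j)"
proof -
  obtain s0 k where k: "0 < k" "\<And>\<phi>. of_nat k * f \<phi> = ev \<phi> s0"
    by (rule basicE[OF f]) (rule that)
  obtain t0 K where K: "0 < K" "\<And>j \<phi>. j \<in> J \<Longrightarrow> of_nat K * g j \<phi> = ev \<phi> (t0 j)"
    by (rule basic_common_denominator[of J g, OF J]) (assumption | rule g | rule that)+
  define L where "L = k * K"
  define s where "s = nmul K s0"
  define t where "t j = nmul k (t0 j)" for j
  have L: "0 < L" and Lf: "of_nat L * f \<phi> = ev \<phi> s" for \<phi>
    using k K by (auto simp: L_def s_def mult_ac simp flip: k(2))
  have Lg: "of_nat L * g j \<phi> = ev \<phi> (t j)" if "j \<in> J" for j \<phi>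
    using that by (simp add: L_def t_def mult_ac flip: K(2))
  obtain s' where s': "s' \<lless> s" "\<And>\<phi>. of_nat L * f' \<phi> \<le> ev \<phi> s'"
    by (rule wb_hatE[OF wb L Lf]) (rule that)
  obtain s1 where s1: "s' \<lless> s1" "s1 \<lless> s"
    using interpolate[OF s'(1)] .
  have "ev \<phi> s \<le> ev \<phi> (\<Sum>j\<in>J. t j)" for \<phi>
  proof -
    have "of_nat L * f \<phi> \<le> of_nat L * (\<Sum>j\<in>J. g j) \<phi>"
      using le by (intro mult_left_mono) (auto simp: le_fun_def)
    then show ?thesis
      by (simp add: Lf Lg sum_fun_apply sum_distrib_left)
  qed
  then obtain M where M: "0 < M" "nmul (M * 1) s1 \<le> nmul (M * Suc 1) (\<Sum>j\<in>J. t j)"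
    using hat_le_imp_nmul_le[OF _ s1(2), of "\<Sum>j\<in>J. t j" 1] by auto
  obtain r where r: "nmul M s' \<le> (\<Sum>j\<in>J. r j)" "\<And>j. j \<in> J \<Longrightarrow> r j \<le> nmul (2 * M) (t j)"
    "\<And>j. j \<in> J \<Longrightarrow> r j \<le> nmul M s1"
  proof (rule O6_sum[OF J])
    show "nmul M s1 \<le> (\<Sum>j\<in>J. nmul (2 * M) (t j))"
      using M(2) by (simp add: nmul_sum[symmetric] mult_2_right mult_2)
    show "nmul M s' \<lless> nmul M s1"
      by (rule way_below_nmul[OF s1(1)])
  qed (rule that)
  define a where "a j = (\<lambda>\<phi>. ennreal (1 / real (L * M)) * ev \<phi> (r j))" for j
  have LM: "0 < L * M" using L M by simp
  have La: "of_nat (L * M) * a j \<phi> = ev \<phi> (r j)" for j \<phi>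
    unfolding a_def by (rule inverse_of_nat_mult_ennreal[OF LM])
  show thesis
  proof (rule that)
    show "a j \<in> basic" for j
      unfolding a_def by (rule basic_frac[OF LM])
    show "f' \<le> (\<Sum>j\<in>J. a j)"
    proof (rule le_funI)
      fix \<phi>
      have "of_nat (L * M) * f' \<phi> = of_nat M * (of_nat L * f' \<phi>)"
        by (simp add: mult_ac)
      also have "\<dots> \<le> ev \<phi> (nmul M s')"
        using s'(2) by (simp add: mult_left_mono)
      also have "\<dots> \<le> ev \<phi> (\<Sum>j\<in>J. r j)"
        by (rule ev_mono[OF r(1)])
      also have "\<dots> = of_nat (L * M) * (\<Sum>j\<in>J. a j) \<phi>"
        by (simp only: ev_sum sum_fun_apply sum_distrib_left La)
      finally show "f' \<phi> \<le> (\<Sum>j\<in>J. a j) \<phi>"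
        unfolding of_nat_mult_cancel_ennreal[OF LM] .
    qed
    show "a j \<le> f" if "j \<in> J" for j
    proof (rule le_funI)
      fix \<phi>
      have "of_nat (L * M) * a j \<phi> \<le> ev \<phi> (nmul M s1)"
        unfolding La using r(3)[OF that] by (rule ev_mono)
      also have "\<dots> \<le> ev \<phi> (nmul M s)"
        using s1(2) by (intro ev_mono nmul_mono way_below_imp_le)
      also have "\<dots> = of_nat (L * M) * f \<phi>"
        by (simp add: mult_ac flip: Lf)
      finally show "a j \<phi> \<le> f \<phi>"
        unfolding of_nat_mult_cancel_ennreal[OF LM] .
    qed
    show "a j \<le> scl 2 (g j)" if "j \<in> J" for j
    proof (rule le_funI)
      fix \<phi>
      have "of_nat (L * M) * a j \<phi> \<le> ev \<phi> (nmul (2 * M) (t j))"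
        unfolding La using r(2)[OF that] by (rule ev_mono)
      also have "\<dots> = of_nat (L * M) * scl 2 (g j) \<phi>"
        using that by (simp add: mult_ac flip: Lg)
      finally show "a j \<phi> \<le> scl 2 (g j) \<phi>"
        unfolding of_nat_mult_cancel_ennreal[OF LM] .
    qed
  qed
qed

text \<open>
  In \<open>s' \<lless> s\<close> the complement of O5 is only determined up to the gap between \<open>s'\<close> and \<open>s\<close>. Averaging
  over a chain \<open>\<sigma> 0 \<lless> \<sigma> 1 \<lless> \<dots>\<close> makes this gap telescope to at most \<open>1 / N\<close> times the top element.
\<close>

lemma riemann_cut:
  fixes x x' :: "'t \<Rightarrow> 'a functional \<Rightarrow> ennreal"
  assumes T: "finite T" and x: "\<And>t. t \<in> T \<Longrightarrow> x t \<in> basic"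
    and wb: "\<And>t. t \<in> T \<Longrightarrow> wb (x' t) (x t)" and N: "0 < N"
  obtains y where "\<And>t. t \<in> T \<Longrightarrow> y t \<in> basic" "\<And>t. t \<in> T \<Longrightarrow> y t \<le> x t"
    "\<And>t. t \<in> T \<Longrightarrow> scl (real N / real (Suc N)) (x' t) \<le> y t"
    "\<And>U g. U \<subseteq> T \<Longrightarrow> g \<in> basic \<Longrightarrow> (\<Sum>t\<in>U. x t) \<le> g \<Longrightarrow>
      \<exists>z\<in>basic. (\<Sum>t\<in>U. y t) + z \<le> g \<and> g \<le> (\<Sum>t\<in>U. y t) + z + scl (1 / real N) g"
proof -
  obtain s K where K: "0 < K" "\<And>t \<phi>. t \<in> T \<Longrightarrow> of_nat K * x t \<phi> = ev \<phi> (s t)"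
    by (rule basic_common_denominator[of T x, OF T]) (assumption | rule x | rule that)+
  have "\<exists>\<sigma>. (\<forall>\<phi> j. of_nat K * x' t \<phi> \<le> ev \<phi> (\<sigma> j)) \<and> (\<forall>j. \<sigma> j \<lless> \<sigma> (Suc j)) \<and> (\<forall>j. \<sigma> j \<lless> s t)"
    if t: "t \<in> T" for t
  proof -
    obtain s' where s': "s' \<lless> s t" "\<And>\<phi>. of_nat K * x' t \<phi> \<le> ev \<phi> s'"
      by (rule wb_hatE[OF wb[OF t] K(1) K(2)[OF t]]) (rule that)
    obtain \<sigma> where "\<And>n. s' \<le> \<sigma> n" "\<And>n. \<sigma> n \<lless> \<sigma> (Suc n)" "\<And>n. \<sigma> n \<lless> s t"
      by (rule way_below_chain[OF s'(1)]) (rule that)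
    then show ?thesis
      using order_trans[OF s'(2) ev_mono] by (intro exI[of _ \<sigma>]) simp
  qed
  then obtain \<sigma> where \<sigma>: "\<And>t \<phi> j. t \<in> T \<Longrightarrow> of_nat K * x' t \<phi> \<le> ev \<phi> (\<sigma> t j)"
    "\<And>t j. t \<in> T \<Longrightarrow> \<sigma> t j \<lless> \<sigma> t (Suc j)" "\<And>t j. t \<in> T \<Longrightarrow> \<sigma> t j \<lless> s t"
    by metis
  \<comment> \<open>\<open>S 1 t + \<sigma> t 0 = S 0 t + \<sigma> t N\<close>, so a shift changes
    only the end terms.\<close>
  define S where "S i t = (\<Sum>j<N. \<sigma> t (j + i))" for i t
  \<comment> \<open>\<open>Suc N\<close> in place of \<open>N\<close>: the resulting factor
    \<open>N / (N + 1)\<close> pays for the loss \<open>(N + 1) / N\<close> in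
    \<open>hat_le_imp_nmul_le\<close>.\<close>
  define P where "P = K * Suc N"
  have P: "0 < P" using K by (simp add: P_def)
  \<comment> \<open>\<open>y\<close> is fixed before any \<open>U\<close> and \<open>g\<close>, so
    the same pieces can be cut from a row and from a column.\<close>
  define y where "y t = (\<lambda>\<phi>. ennreal (1 / real P) * ev \<phi> (S 0 t))" for t
  have Py: "of_nat P * y t \<phi> = ev \<phi> (S 0 t)" for t \<phi>
    unfolding y_def by (rule inverse_of_nat_mult_ennreal[OF P])
  have S_le: "ev \<phi> (S i t) \<le> of_nat (N * K) * x t \<phi>" if "t \<in> T" for i t \<phi>
  proof -
    have "ev \<phi> (S i t) \<le> (\<Sum>j<N. ev \<phi> (s t))"
      unfolding S_def ev_sum using \<sigma>(3)[OF that] by (intro sum_mono ev_mono way_below_imp_le)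
    then show ?thesis
      using that by (simp add: mult.assoc flip: K(2))
  qed
  show thesis
  proof (rule that)
    fix t assume t: "t \<in> T"
    show "y t \<in> basic"
      unfolding y_def by (rule basic_frac[OF P])
    show "y t \<le> x t"
    proof (rule le_funI)
      fix \<phi>
      have "of_nat P * y t \<phi> \<le> of_nat (N * K) * x t \<phi>"
        unfolding Py by (rule S_le[OF t])
      also have "\<dots> \<le> of_nat P * x t \<phi>"
        by (intro mult_right_mono of_nat_mono) (auto simp: P_def)
      finally show "y t \<phi> \<le> x t \<phi>"
        unfolding of_nat_mult_cancel_ennreal[OF P] .
    qed
    show "scl (real N / real (Suc N)) (x' t) \<le> y t"
    proof (rule le_funI)
      fix \<phi>
      have "real P * (real N / real (Suc N)) = real (N * K)"
        by (simp add: P_def field_simps del: of_nat_Suc) (simp add: algebra_simps)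
      then have "ennreal (real P) * ennreal (real N / real (Suc N)) = ennreal (real (N * K))"
        by (metis ennreal_mult' of_nat_0_le_iff)
      then have "(of_nat P :: ennreal) * ennreal (real N / real (Suc N)) = of_nat (N * K)"
        by (simp only: ennreal_of_nat_eq_real_of_nat)
      then have "of_nat P * scl (real N / real (Suc N)) (x' t) \<phi> = (\<Sum>j<N. of_nat K * x' t \<phi>)"
        by (simp add: mult.assoc[symmetric])
      also have "\<dots> \<le> ev \<phi> (S 0 t)"
        unfolding S_def ev_sum by (intro sum_mono) (simp add: \<sigma>(1)[OF t])
      finally show "scl (real N / real (Suc N)) (x' t) \<phi> \<le> y t \<phi>"
        unfolding Py[symmetric] of_nat_mult_cancel_ennreal[OF P] .
    qed
  next
    fix U g assume U: "U \<subseteq> T" and g: "g \<in> basic" and le: "(\<Sum>t\<in>U. x t) \<le> g"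
    obtain u L where L: "0 < L" "\<And>\<phi>. of_nat L * g \<phi> = ev \<phi> u"
      by (rule basicE[OF g]) (rule that)
    define A where "A i = (\<Sum>t\<in>U. S i t)" for i
    have AA: "A i \<lless> A (Suc i)" for i
      unfolding A_def S_def using \<sigma>(2) U by (intro way_below_sum) auto
    have sum_le: "(\<Sum>t\<in>U. x t \<phi>) \<le> g \<phi>" for \<phi>
      using le by (simp add: le_fun_def sum_fun_apply)
    have "ev \<phi> (nmul L (A 2)) \<le> ev \<phi> (nmul (N * K) u)" for \<phi>
    proof -
      have "ev \<phi> (A 2) \<le> (\<Sum>t\<in>U. of_nat (N * K) * x t \<phi>)"
        unfolding A_def ev_sum using S_le U by (intro sum_mono) auto
      also have "\<dots> \<le> of_nat (N * K) * g \<phi>"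
        unfolding sum_distrib_left[symmetric] by (intro mult_left_mono sum_le) auto
      finally have "of_nat L * ev \<phi> (A 2) \<le> of_nat L * (of_nat (N * K) * g \<phi>)"
        by (intro mult_left_mono) auto
      then show ?thesis
        by (simp add: mult.left_commute[of "of_nat L"] flip: L(2))
    qed
    \<comment> \<open>Three shifts are in use: the comparison of functions shrinks
      \<open>A 2\<close> to \<open>A 1\<close>, and O5 needs the gap between \<open>A 0\<close> and
      \<open>A 1\<close>.\<close>
    moreover have "nmul L (A 1) \<lless> nmul L (A 2)"
      using way_below_nmul[OF AA[of 1]] by (simp add: numeral_2_eq_2)
    ultimately obtain M where M: "0 < M"
      "nmul (M * N) (nmul L (A 1)) \<le> nmul (M * Suc N) (nmul (N * K) u)"
      using hat_le_imp_nmul_le[of "nmul L (A 2)" "nmul (N * K) u" "nmul L (A 1)" N] N by blast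
    define R where "R = M * N * L"
    define Q where "Q = R * P"
    have Q: "0 < Q" using M N L P by (simp add: Q_def R_def)
    define v where "v = nmul (M * Suc N) (nmul (N * K) u)"
    have Qg: "of_nat Q * g \<phi> = ev \<phi> v" for \<phi>
      by (simp add: v_def Q_def R_def P_def algebra_simps flip: L(2))
    have "nmul R (A 0) \<lless> nmul R (A 1)"
      using way_below_nmul[OF AA[of 0]] by simp
    moreover have "nmul R (A 1) \<le> v"
      using M(2) by (simp add: v_def R_def nmul_nmul)
    ultimately obtain r where r: "nmul R (A 0) + r \<le> v" "v \<le> nmul R (A 1) + r"
      using O5 unfolding axiom_O5_def by blast
    define z where "z = (\<lambda>\<phi>. ennreal (1 / real Q) * ev \<phi> r)"
    have Qz: "of_nat Q * z \<phi> = ev \<phi> r" for \<phi>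
      unfolding z_def by (rule inverse_of_nat_mult_ennreal[OF Q])
    have Qy: "of_nat Q * (\<Sum>t\<in>U. y t) \<phi> = of_nat R * ev \<phi> (A 0)" for \<phi>
      by (simp add: Q_def A_def sum_fun_apply sum_distrib_left mult.assoc flip: Py)
    have A1: "ev \<phi> (A 1) \<le> ev \<phi> (A 0) + of_nat K * g \<phi>" for \<phi>
    proof -
      have "ev \<phi> (S 1 t) \<le> ev \<phi> (S 0 t) + of_nat K * x t \<phi>" if "t \<in> T" for t
      proof -
        have "S 1 t \<le> \<sigma> t 0 + S 1 t"
          by (simp add: add_increasing zero_least)
        also have "\<dots> = S 0 t + \<sigma> t N"
          unfolding S_def using sum.lessThan_Suc_shift[of "\<sigma> t" N] by simp
        also have "\<dots> \<le> S 0 t + s t"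
          using \<sigma>(3)[OF that] by (intro add_left_mono way_below_imp_le)
        finally show ?thesis
          using ev_mono K(2)[OF that] by fastforce
      qed
      then have "ev \<phi> (A 1) \<le> (\<Sum>t\<in>U. ev \<phi> (S 0 t) + of_nat K * x t \<phi>)"
        unfolding A_def ev_sum using U by (intro sum_mono) auto
      also have "\<dots> = ev \<phi> (A 0) + of_nat K * (\<Sum>t\<in>U. x t \<phi>)"
        by (simp add: A_def sum.distrib sum_distrib_left)
      also have "\<dots> \<le> ev \<phi> (A 0) + of_nat K * g \<phi>"
        by (intro add_left_mono mult_left_mono sum_le) auto
      finally show ?thesis .
    qed
    show "\<exists>z\<in>basic. (\<Sum>t\<in>U. y t) + z \<le> g \<and> g \<le> (\<Sum>t\<in>U. y t) + z + scl (1 / real N) g"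
    proof (intro bexI[of _ z] conjI le_funI)
      show "z \<in> basic"
        unfolding z_def by (rule basic_frac[OF Q])
      fix \<phi>
      have "of_nat Q * ((\<Sum>t\<in>U. y t) + z) \<phi> = ev \<phi> (nmul R (A 0) + r)"
        by (simp add: distrib_left Qy Qz)
      also have "\<dots> \<le> of_nat Q * g \<phi>"
        unfolding Qg by (rule ev_mono[OF r(1)])
      finally show "((\<Sum>t\<in>U. y t) + z) \<phi> \<le> g \<phi>"
        unfolding of_nat_mult_cancel_ennreal[OF Q] .
      have "of_nat Q * g \<phi> \<le> ev \<phi> (nmul R (A 1) + r)"
        unfolding Qg by (rule ev_mono[OF r(2)])
      also have "\<dots> \<le> of_nat R * (ev \<phi> (A 0) + of_nat K * g \<phi>) + ev \<phi> r"
        unfolding ev_add ev_nmul by (intro add_right_mono mult_left_mono A1) auto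
      also have "\<dots> = of_nat Q * ((\<Sum>t\<in>U. y t) + z) \<phi> + of_nat (R * K) * g \<phi>"
        by (simp add: distrib_left Qy Qz add_ac mult_ac)
      \<comment> \<open>Since \<open>Q = R * K * (N + 1)\<close>, the telescoped gap
        \<open>R * K\<close> is at most \<open>Q / N\<close>.\<close>
      also have "of_nat (R * K) * g \<phi> \<le> of_nat Q * scl (1 / real N) g \<phi>"
      proof -
        have "real (R * K) \<le> real Q * (1 / real N)"
          using N by (simp add: Q_def P_def field_simps)
        then have "ennreal (real (R * K)) \<le> ennreal (real Q) * ennreal (1 / real N)"
          by (simp add: ennreal_leI flip: ennreal_mult')
        then have "of_nat (R * K) \<le> of_nat Q * ennreal (1 / real N)"
          by (simp only: ennreal_of_nat_eq_real_of_nat)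
        then show ?thesis
          using mult_right_mono[of _ _ "g \<phi>"] by (fastforce simp: mult.assoc)
      qed
      finally have "of_nat Q * g \<phi> \<le> of_nat Q * ((\<Sum>t\<in>U. y t) + z + scl (1 / real N) g) \<phi>"
        by (simp add: distrib_left add_left_mono)
      then show "g \<phi> \<le> ((\<Sum>t\<in>U. y t) + z + scl (1 / real N) g) \<phi>"
        unfolding of_nat_mult_cancel_ennreal[OF Q] .
    qed
  qed
qed

text \<open>
  Replacing \<open>y, z\<close> by \<open>(1 - e) y, (1 - e) z + e g\<close> forces the complement to be infinite wherever \<open>g\<close>
  is, so that the error term can be absorbed into it.
\<close>

lemma multiplicative_cut:
  fixes x x' :: "'t \<Rightarrow> 'a functional \<Rightarrow> ennreal"
  assumes T: "finite T" and x: "\<And>t. t \<in> T \<Longrightarrow> x t \<in> basic"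
    and wb: "\<And>t. t \<in> T \<Longrightarrow> wb (x' t) (x t)" and n: "1 < n" and e: "e = 1 / real n"
  obtains y where "\<And>t. t \<in> T \<Longrightarrow> y t \<in> basic"
    "\<And>t. t \<in> T \<Longrightarrow> scl ((1 - e)\<^sup>2) (x' t) \<le> y t"
    "\<And>U g. U \<subseteq> T \<Longrightarrow> g \<in> basic \<Longrightarrow> (\<Sum>t\<in>U. x t) \<le> g \<Longrightarrow>
      \<exists>w\<in>basic. (\<Sum>t\<in>U. y t) + w \<le> g \<and> g \<le> (\<Sum>t\<in>U. y t) + scl (1 + e) w"
proof -
  have e01: "0 < e" "e < 1" and eQ: "e \<in> \<rat>"
    using n by (auto simp: e)
  \<comment> \<open>Chains of length \<open>n^2\<close> make the additive error \<open>e^2\<close>,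
    the size that \<open>cut_rescale\<close> asks for.\<close>
  have n2: "0 < n ^ 2" "1 / real (n ^ 2) = e\<^sup>2"
    using n by (auto simp: e power_divide)
  obtain y where y: "\<And>t. t \<in> T \<Longrightarrow> y t \<in> basic"
    "\<And>t. t \<in> T \<Longrightarrow> scl (real (n ^ 2) / real (Suc (n ^ 2))) (x' t) \<le> y t"
    "\<And>U g. U \<subseteq> T \<Longrightarrow> g \<in> basic \<Longrightarrow> (\<Sum>t\<in>U. x t) \<le> g \<Longrightarrow>
      \<exists>z\<in>basic. (\<Sum>t\<in>U. y t) + z \<le> g \<and> g \<le> (\<Sum>t\<in>U. y t) + z + scl (1 / real (n ^ 2)) g"
    by (rule riemann_cut[of T x x' "n ^ 2", OF T x wb n2(1)]) (assumption | rule that)+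
  show thesis
  proof (rule that[of "\<lambda>t. scl (1 - e) (y t)"])
    fix t assume t: "t \<in> T"
    show "scl (1 - e) (y t) \<in> basic"
      using y(1)[OF t] eQ by (intro basic_scl) auto
    \<comment> \<open>One factor \<open>1 - e\<close> of the lower bound covers
      \<open>n^2 / (n^2 + 1)\<close>; the other is the rescaling of \<open>y\<close>.\<close>
    have "1 - e \<le> real (n ^ 2) / real (Suc (n ^ 2))"
    proof -
      have "real n \<le> real n * real n"
        using mult_left_mono[of 1 "real n" "real n"] n by simp
      then have "1 / (real n * real n + 1) \<le> 1 / real n"
        using n by (intro frac_le) linarith+
      then have "1 - 1 / real n \<le> 1 - 1 / (real n * real n + 1)"
        by simp
      also have "\<dots> = real (n ^ 2) / real (Suc (n ^ 2))"
        using n by (simp add: field_simps power2_eq_square add_nonneg_eq_0_iff)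
      finally show ?thesis by (simp add: e)
    qed
    then have "scl (1 - e) (x' t) \<le> y t"
      using y(2)[OF t] scl_mono_left order_trans by blast
    then have "scl (1 - e) (scl (1 - e) (x' t)) \<le> scl (1 - e) (y t)"
      by (rule scl_mono)
    then show "scl ((1 - e)\<^sup>2) (x' t) \<le> scl (1 - e) (y t)"
      using e01 by (simp add: scl_scl power2_eq_square)
  next
    fix U g assume U: "U \<subseteq> T" "g \<in> basic" "(\<Sum>t\<in>U. x t) \<le> g"
    obtain z where z: "z \<in> basic" "(\<Sum>t\<in>U. y t) + z \<le> g" "g \<le> (\<Sum>t\<in>U. y t) + z + scl (e\<^sup>2) g"
      using y(3)[OF U] n2(2) by metis
    have "(\<Sum>t\<in>U. y t) \<phi> + z \<phi> \<le> g \<phi>" "g \<phi> \<le> (\<Sum>t\<in>U. y t) \<phi> + z \<phi> + ennreal (e\<^sup>2) * g \<phi>" for \<phi>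
      using z(2,3) by (auto simp: le_fun_def)
    note res = cut_rescale[OF e01 this]
    have "scl (1 - e) z + scl e g \<in> basic"
      using z U eQ by (intro basic_add basic_scl) auto
    then show "\<exists>w\<in>basic. (\<Sum>t\<in>U. scl (1 - e) (y t)) + w \<le> g \<and>
        g \<le> (\<Sum>t\<in>U. scl (1 - e) (y t)) + scl (1 + e) w"
      using res by (intro bexI[of _ "scl (1 - e) z + scl e g"]) (auto simp: le_fun_def sum_scl_apply)
  qed
qed

text \<open>\<open>wb_sumE\<close> for two summands indexed by \<open>bool\<close>, where the first
  is afterwards put back to \<open>a\<close>. The shrunk \<open>w'\<close> can then be fed to a
  further decomposition as a lower bound for \<open>w\<close>.\<close>

lemma wb_add_sclE:
  fixes x a w :: "'a functional \<Rightarrow> ennreal"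
  assumes wb: "wb x (a + scl r w)" and a: "a \<in> basic" and w: "w \<in> basic" and r: "r \<in> \<rat>" "0 < r"
  obtains w' where "w' \<in> basic" "wb w' w" "x \<le> a + scl r w'"
proof -
  define y where "y b = (if b then a else scl r w)" for b
  have "wb x (\<Sum>b\<in>UNIV. y b)"
    using wb by (simp add: y_def UNIV_bool add.commute)
  moreover have "y b \<in> S_R" for b
    using a w r by (auto simp: y_def intro: basic_in_S_R basic_scl)
  ultimately obtain z where z: "\<And>b. z b \<in> basic" "\<And>b. wb (z b) (y b)" "x \<le> (\<Sum>b\<in>UNIV. z b)"
    using wb_sumE[of UNIV y x] by auto
  show thesis
  proof (rule that)
    show "scl (1 / r) (z False) \<in> basic"
      using z(1) r by (intro basic_scl) auto
    have "wb (scl (1 / r) (z False)) (scl (1 / r) (scl r w))"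
      using z(2)[of False] r by (intro wb_scl) (auto simp: y_def)
    then show "wb (scl (1 / r) (z False)) w"
      using r by (simp add: scl_scl)
    have "x \<le> z True + z False"
      using z(3) by (simp add: UNIV_bool add.commute)
    also have "\<dots> \<le> a + z False"
      using wb_imp_le[OF z(2)[of True]] by (intro add_right_mono) (simp add: y_def)
    finally show "x \<le> a + scl r (scl (1 / r) (z False))"
      using r by (simp add: scl_scl)
  qed
qed

end

section \<open>Decompositions up to a constant\<close>

text \<open>The upper bounds on row and column sums are exact; only the lower bound by
  \<open>f'\<close> is relaxed by \<open>c\<close>. The relation \<open>wb (f' i) (f i)\<close> is
  the gap that the comparison lemmas consume.\<close>

definition decomposes :: "'i set \<Rightarrow> 'j set \<Rightarrow> real \<Rightarrow> 'a::ordered_semigroup itself \<Rightarrow> bool" where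
  "decomposes I J c _ \<longleftrightarrow> (\<forall>f f' (g :: 'j \<Rightarrow> 'a functional \<Rightarrow> ennreal).
     (\<forall>i\<in>I. f i \<in> basic) \<and> (\<forall>j\<in>J. g j \<in> basic) \<and> (\<Sum>i\<in>I. f i) \<le> (\<Sum>j\<in>J. g j) \<and>
     (\<forall>i\<in>I. wb (f' i) (f i)) \<longrightarrow>
     (\<exists>h. (\<forall>i\<in>I. \<forall>j\<in>J. h i j \<in> basic) \<and> (\<forall>i\<in>I. (\<Sum>j\<in>J. h i j) \<le> f i) \<and>
          (\<forall>j\<in>J. (\<Sum>i\<in>I. h i j) \<le> g j) \<and> (\<forall>i\<in>I. scl c (f' i) \<le> (\<Sum>j\<in>J. h i j))))"

lemma decomposesE:
  fixes g :: "'j \<Rightarrow> 'a::ordered_semigroup functional \<Rightarrow> ennreal"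
  assumes "decomposes I J c TYPE('a)" "\<And>i. i \<in> I \<Longrightarrow> f i \<in> basic" "\<And>j. j \<in> J \<Longrightarrow> g j \<in> basic"
    "(\<Sum>i\<in>I. f i) \<le> (\<Sum>j\<in>J. g j)" "\<And>i. i \<in> I \<Longrightarrow> wb (f' i) (f i)"
  obtains h where "\<And>i j. i \<in> I \<Longrightarrow> j \<in> J \<Longrightarrow> h i j \<in> basic" "\<And>i. i \<in> I \<Longrightarrow> (\<Sum>j\<in>J. h i j) \<le> f i"
    "\<And>j. j \<in> J \<Longrightarrow> (\<Sum>i\<in>I. h i j) \<le> g j" "\<And>i. i \<in> I \<Longrightarrow> scl c (f' i) \<le> (\<Sum>j\<in>J. h i j)"
proof -
  have "\<exists>h. (\<forall>i\<in>I. \<forall>j\<in>J. h i j \<in> basic) \<and> (\<forall>i\<in>I. (\<Sum>j\<in>J. h i j) \<le> f i) \<and>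
          (\<forall>j\<in>J. (\<Sum>i\<in>I. h i j) \<le> g j) \<and> (\<forall>i\<in>I. scl c (f' i) \<le> (\<Sum>j\<in>J. h i j))"
    by (rule assms(1)[unfolded decomposes_def, rule_format]) (use assms(2-) in simp)
  then obtain h where h: "\<forall>i\<in>I. \<forall>j\<in>J. h i j \<in> basic" "\<forall>i\<in>I. (\<Sum>j\<in>J. h i j) \<le> f i"
    "\<forall>j\<in>J. (\<Sum>i\<in>I. h i j) \<le> g j" "\<forall>i\<in>I. scl c (f' i) \<le> (\<Sum>j\<in>J. h i j)"
    by blast
  show thesis
    by (rule that[of h]) (use h in simp_all)
qed

lemma decomposes_0: "decomposes I J 0 TYPE('a::ordered_semigroup)"
  unfolding decomposes_def
  by (intro allI impI exI[of _ "\<lambda>_ _. 0"]) (auto simp: basic_0 scl_def le_fun_def sum_fun_apply)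

lemma decomposes_mono:
  fixes J :: "'j set"
  assumes "decomposes I J c TYPE('a::ordered_semigroup)" "d \<le> c"
  shows "decomposes I J d TYPE('a)"
  unfolding decomposes_def
proof (intro allI impI; elim conjE)
  fix f f' and g :: "'j \<Rightarrow> 'a functional \<Rightarrow> ennreal"
  assume *: "\<forall>i\<in>I. f i \<in> basic" "\<forall>j\<in>J. g j \<in> basic" "(\<Sum>i\<in>I. f i) \<le> (\<Sum>j\<in>J. g j)"
    "\<forall>i\<in>I. wb (f' i) (f i)"
  obtain h where h: "\<And>i j. i \<in> I \<Longrightarrow> j \<in> J \<Longrightarrow> h i j \<in> basic" "\<And>i. i \<in> I \<Longrightarrow> (\<Sum>j\<in>J. h i j) \<le> f i"
    "\<And>j. j \<in> J \<Longrightarrow> (\<Sum>i\<in>I. h i j) \<le> g j" "\<And>i. i \<in> I \<Longrightarrow> scl c (f' i) \<le> (\<Sum>j\<in>J. h i j)"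
    by (rule decomposesE[OF assms(1), of f g f']) ((rule that; assumption) | (use * in simp))+
  have "scl d (f' i) \<le> (\<Sum>j\<in>J. h i j)" if "i \<in> I" for i
    by (rule order_trans[OF scl_mono_left[OF assms(2)] h(4)[OF that]])
  with h show "\<exists>h. (\<forall>i\<in>I. \<forall>j\<in>J. h i j \<in> basic) \<and> (\<forall>i\<in>I. (\<Sum>j\<in>J. h i j) \<le> f i) \<and>
          (\<forall>j\<in>J. (\<Sum>i\<in>I. h i j) \<le> g j) \<and> (\<forall>i\<in>I. scl d (f' i) \<le> (\<Sum>j\<in>J. h i j))"
    by (intro exI[of _ h]) simp
qed

lemma sum_scl_le:
  fixes x :: "'i \<Rightarrow> 'b \<Rightarrow> ennreal"
  assumes I: "finite I" "card I \<le> D" and D: "0 < D" and c: "0 < c"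
    and x: "\<And>i. i \<in> I \<Longrightarrow> x i \<le> scl c f"
  shows "(\<Sum>i\<in>I. scl (1 / (c * real D)) (x i)) \<le> f"
proof (rule le_funI)
  fix \<phi>
  have "(\<Sum>i\<in>I. scl (1 / (c * real D)) (x i)) \<phi> \<le> (\<Sum>i\<in>I. ennreal (1 / (c * real D)) * (ennreal c * f \<phi>))"
    unfolding sum_fun_apply scl_apply
    by (intro sum_mono mult_left_mono) (use x in \<open>auto simp: le_fun_def\<close>)
  also have "\<dots> = of_nat (card I) * (ennreal (1 / real D) * f \<phi>)"
    using c by (simp add: mult.assoc[symmetric] flip: ennreal_mult')
  also have "\<dots> \<le> of_nat D * (ennreal (1 / real D) * f \<phi>)"
    using I by (intro mult_right_mono of_nat_mono) auto
  also have "\<dots> = f \<phi>"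
    by (rule inverse_of_nat_mult_ennreal[OF D])
  finally show "(\<Sum>i\<in>I. scl (1 / (c * real D)) (x i)) \<phi> \<le> f \<phi>" .
qed

text \<open>A finite \<open>a\<close> can be cancelled; for an infinite one the slack is infinite
  too.\<close>

lemma ennreal_cancel_with_slack:
  fixes a w z F G :: ennreal
  assumes "a + w \<le> F" "F \<le> G" "G \<le> a + ennreal r * z" "0 < e"
  shows "w \<le> ennreal r * z + ennreal e * a"
proof (cases "a = top")
  case True
  then show ?thesis using assms(4) by (simp add: ennreal_mult_top)
next
  case False
  have "a + w \<le> a + ennreal r * z"
    using assms by (blast intro: order_trans)
  then have "w \<le> ennreal r * z"
    using False by (simp add: ennreal_add_left_cancel_le)
  then show ?thesis
    by (rule order_trans) simp
qed

text \<open>With \<open>E = (1 + e) * D\<close> the third hypothesis gives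
  \<open>E * k \<ge> (1 + e) * w\<close>, so \<open>E * (y + k) \<ge> (E - 1) * y + y + (1 + e) * w
  \<ge> (E - 1) * b * F + F\<close>.\<close>

lemma improved_lower_bound:
  fixes F y w k :: ennreal
  assumes e: "0 < e" and D: "1 \<le> D" and b: "0 \<le> b"
    and 1: "ennreal b * F \<le> y" and 2: "F \<le> y + ennreal (1 + e) * w" and 3: "ennreal (1 / D) * w \<le> k"
  shows "ennreal ((((1 + e) * D - 1) * b + 1) / ((1 + e) * D * (1 + e))) * F \<le> ennreal (1 / (1 + e)) * (y + k)"
proof (cases "y = top \<or> k = top")
  case True
  then show ?thesis
    using e by (auto simp: ennreal_mult_top)
next
  case False
  define E where "E = (1 + e) * D"
  have E: "1 \<le> E" "0 < E"
    using e D mult_mono[of 1 "1 + e" 1 D] by (auto simp: E_def)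
  have "w \<noteq> top"
    using 3 False D by (auto simp: ennreal_mult_top top_unique)
  moreover from this have "F \<noteq> top"
    using 2 False by (auto simp: top_unique ennreal_mult_eq_top_iff)
  ultimately obtain F' y' w' k' where r: "F = ennreal F'" "y = ennreal y'" "w = ennreal w'" "k = ennreal k'"
    "0 \<le> F'" "0 \<le> y'" "0 \<le> w'" "0 \<le> k'"
    using False by (metis ennreal_cases)
  have 1: "b * F' \<le> y'"
    using 1 r b by (simp flip: ennreal_mult)
  have 2: "F' \<le> y' + (1 + e) * w'"
    using 2 r e by (simp flip: ennreal_mult ennreal_plus)
  have "1 / D * w' \<le> k'"
    using 3 r D by (simp flip: ennreal_mult)
  then have "w' \<le> D * k'"
    using D by (simp add: field_simps)
  then have "(1 + e) * w' \<le> E * k'"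
    using e mult_left_mono[of w' "D * k'" "1 + e"] by (simp add: E_def mult.assoc)
  moreover have "(E - 1) * (b * F') \<le> (E - 1) * y'"
    using 1 E by (intro mult_left_mono) auto
  ultimately have "((E - 1) * b + 1) * F' \<le> E * (y' + k')"
    using 2 by (simp add: algebra_simps)
  then have "((E - 1) * b + 1) * F' / (E * (1 + e)) \<le> E * (y' + k') / (E * (1 + e))"
    using E e by (intro divide_right_mono) auto
  then have "((E - 1) * b + 1) / (E * (1 + e)) * F' \<le> 1 / (1 + e) * (y' + k')"
    using E by simp
  moreover have "0 \<le> ((E - 1) * b + 1) / (E * (1 + e))"
    using E e b by simp
  ultimately show ?thesis
    using r e unfolding E_def[symmetric] by (simp flip: ennreal_mult ennreal_plus)
qed

context Cu_semigroup
begin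

text \<open>Each row is split on its own, since \<open>f i\<close> alone is below the sum of the
  \<open>g j\<close>. Division by \<open>2 * D\<close> pays for the factor 2 of
  \<open>O6_basic\<close> and for the at most \<open>D\<close> rows that share a column.\<close>

lemma decomposes_initial:
  assumes I: "finite I" "card I \<le> D" and J: "finite J" "card J \<le> D" and D: "0 < D"
  shows "decomposes I J (1 / (2 * real D)) TYPE('a)"
  unfolding decomposes_def
proof (intro allI impI; elim conjE)
  fix f f' and g :: "'c \<Rightarrow> 'a functional \<Rightarrow> ennreal"
  assume f: "\<forall>i\<in>I. f i \<in> basic" and g: "\<forall>j\<in>J. g j \<in> basic"
    and le: "(\<Sum>i\<in>I. f i) \<le> (\<Sum>j\<in>J. g j)" and wb: "\<forall>i\<in>I. wb (f' i) (f i)"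
  have ex: "\<exists>a. (\<forall>j\<in>J. a j \<in> basic) \<and> f' i \<le> (\<Sum>j\<in>J. a j) \<and> (\<forall>j\<in>J. a j \<le> f i \<and> a j \<le> scl 2 (g j))"
    if i: "i \<in> I" for i
  proof -
    have "f i \<le> (\<Sum>i\<in>I. f i)"
      using I i by (intro member_le_sum) (auto simp: le_fun_def)
    then have fi: "f i \<le> (\<Sum>j\<in>J. g j)"
      using le by (rule order_trans)
    obtain a where "\<And>j. j \<in> J \<Longrightarrow> a j \<in> basic" "f' i \<le> (\<Sum>j\<in>J. a j)"
      "\<And>j. j \<in> J \<Longrightarrow> a j \<le> f i" "\<And>j. j \<in> J \<Longrightarrow> a j \<le> scl 2 (g j)"
      by (rule O6_basic[OF J(1), of "f i" g "f' i"]) ((rule that; assumption) | (use f g wb i fi in simp))+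
    then show ?thesis
      by (intro exI[of _ a]) simp
  qed
  have "\<exists>a. \<forall>i\<in>I. (\<forall>j\<in>J. a i j \<in> basic) \<and> f' i \<le> (\<Sum>j\<in>J. a i j) \<and>
      (\<forall>j\<in>J. a i j \<le> f i \<and> a i j \<le> scl 2 (g j))"
    by (intro bchoice ballI) (rule ex)
  then obtain a where a: "\<forall>i\<in>I. (\<forall>j\<in>J. a i j \<in> basic) \<and> f' i \<le> (\<Sum>j\<in>J. a i j) \<and>
      (\<forall>j\<in>J. a i j \<le> f i \<and> a i j \<le> scl 2 (g j))" ..
  define h where "h i j = scl (1 / (2 * real D)) (a i j)" for i j
  have "h i j \<in> basic" if "i \<in> I" "j \<in> J" for i j
    unfolding h_def using a that by (intro basic_scl) auto
  moreover have "(\<Sum>j\<in>J. h i j) \<le> f i" if "i \<in> I" for i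
  proof -
    have "a i j \<le> scl 2 (f i)" if "j \<in> J" for j
      using a that \<open>i \<in> I\<close> scl_mono_left[of 1 2 "f i"] order_trans by fastforce
    then show ?thesis
      using sum_scl_le[OF J D, of 2 "a i" "f i"] by (simp add: h_def)
  qed
  moreover have "(\<Sum>i\<in>I. h i j) \<le> g j" if "j \<in> J" for j
    using sum_scl_le[OF I D, of 2 "\<lambda>i. a i j" "g j"] a that by (simp add: h_def)
  moreover have "scl (1 / (2 * real D)) (f' i) \<le> (\<Sum>j\<in>J. h i j)" if "i \<in> I" for i
    using a that unfolding h_def le_fun_def sum_scl_apply scl_apply by (auto intro: mult_left_mono)
  ultimately show "\<exists>h. (\<forall>i\<in>I. \<forall>j\<in>J. h i j \<in> basic) \<and> (\<forall>i\<in>I. (\<Sum>j\<in>J. h i j) \<le> f i) \<and>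
          (\<forall>j\<in>J. (\<Sum>i\<in>I. h i j) \<le> g j) \<and> (\<forall>i\<in>I. scl (1 / (2 * real D)) (f' i) \<le> (\<Sum>j\<in>J. h i j))"
    by (intro exI[of _ h]) simp
qed

text \<open>
  A decomposition with constant \<open>c\<close> is cut out of all rows and columns, and the remainders are
  decomposed with the constant \<open>1 / D\<close>. The column remainders are enlarged by \<open>e\<close> times the part
  cut out, so that the inequality between the sums survives at functionals where it is infinite.
\<close>

lemma decomposes_improve:
  assumes I: "finite I" and J: "finite J" and D: "1 \<le> D"
    and dec_D: "decomposes I J (1 / D) TYPE('a)" and dec_c: "decomposes I J c TYPE('a)"
    and c: "c \<in> \<rat>" "0 \<le> c" and n: "1 < n" and e: "e = 1 / real n"
  shows "decomposes I J ((((1 + e) * D - 1) * ((1 - e)\<^sup>2 * c) + 1) / ((1 + e) * D * (1 + e))) TYPE('a)"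
    (is "decomposes I J ?c' _")
  unfolding decomposes_def
proof (intro allI impI; elim conjE)
  fix f f' and g :: "'c \<Rightarrow> 'a functional \<Rightarrow> ennreal"
  assume f: "\<forall>i\<in>I. f i \<in> basic" and g: "\<forall>j\<in>J. g j \<in> basic"
    and le: "(\<Sum>i\<in>I. f i) \<le> (\<Sum>j\<in>J. g j)" and wb: "\<forall>i\<in>I. wb (f' i) (f i)"
  have e01: "0 < e" "e < 1" and eQ: "e \<in> \<rat>"
    using n by (auto simp: e)
  have ex: "\<exists>z. z \<in> basic \<and> wb (f' i) z \<and> wb z (f i)" if "i \<in> I" for i
    by (rule wb_interpolate[of "f' i" "f i"]) (use f wb that basic_in_S_R in auto)
  \<comment> \<open>The pieces \<open>x i j\<close> are bounded below through \<open>p\<close>, not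
    \<open>f'\<close>: cutting shrinks them to \<open>x' i j\<close>, which still have to dominate
    \<open>scl c (f' i)\<close>.\<close>
  have "\<exists>p. \<forall>i\<in>I. p i \<in> basic \<and> wb (f' i) (p i) \<and> wb (p i) (f i)"
    by (intro bchoice ballI) (rule ex)
  then obtain p where p: "\<forall>i\<in>I. p i \<in> basic \<and> wb (f' i) (p i) \<and> wb (p i) (f i)" ..
  obtain x where x: "\<And>i j. i \<in> I \<Longrightarrow> j \<in> J \<Longrightarrow> x i j \<in> basic" "\<And>i. i \<in> I \<Longrightarrow> (\<Sum>j\<in>J. x i j) \<le> f i"
    "\<And>j. j \<in> J \<Longrightarrow> (\<Sum>i\<in>I. x i j) \<le> g j" "\<And>i. i \<in> I \<Longrightarrow> scl c (p i) \<le> (\<Sum>j\<in>J. x i j)"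
    by (rule decomposesE[OF dec_c, of f g p]) ((rule that; assumption) | (use f g le p in simp))+
  have ex: "\<exists>x'. (\<forall>j\<in>J. x' j \<in> basic \<and> wb (x' j) (x i j)) \<and> scl c (f' i) \<le> (\<Sum>j\<in>J. x' j)"
    if i: "i \<in> I" for i
  proof -
    have "wb (scl c (f' i)) (scl c (p i))"
      using p i c by (intro wb_scl) auto
    then have w: "wb (scl c (f' i)) (\<Sum>j\<in>J. x i j)"
      by (rule wb_mono[OF order_refl _ x(4)[OF i]])
    obtain z where "\<And>j. j \<in> J \<Longrightarrow> z j \<in> basic" "\<And>j. j \<in> J \<Longrightarrow> wb (z j) (x i j)"
      "scl c (f' i) \<le> (\<Sum>j\<in>J. z j)"
      by (rule wb_sumE[OF J _ w]) (use x(1)[OF i] basic_in_S_R in auto)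
    then show ?thesis
      by (intro exI[of _ z]) simp
  qed
  have "\<exists>x'. \<forall>i\<in>I. (\<forall>j\<in>J. x' i j \<in> basic \<and> wb (x' i j) (x i j)) \<and>
      scl c (f' i) \<le> (\<Sum>j\<in>J. x' i j)"
    by (intro bchoice ballI) (rule ex)
  then obtain x' where x': "\<forall>i\<in>I. (\<forall>j\<in>J. x' i j \<in> basic \<and> wb (x' i j) (x i j)) \<and>
      scl c (f' i) \<le> (\<Sum>j\<in>J. x' i j)" ..
  have x_basic: "case_prod x t \<in> basic" if "t \<in> I \<times> J" for t
    using that x(1) by (cases t) simp
  have x_wb: "wb (case_prod x' t) (case_prod x t)" if "t \<in> I \<times> J" for t
    using that x' by (cases t) simp
  \<comment> \<open>All pairs are cut at once; \<open>U = {i} \<times> J\<close> and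
    \<open>U = I \<times> {j}\<close> then give complements of the same pieces in every row and
    column.\<close>
  obtain Y where Y: "\<And>t. t \<in> I \<times> J \<Longrightarrow> Y t \<in> basic"
    "\<And>t. t \<in> I \<times> J \<Longrightarrow> scl ((1 - e)\<^sup>2) (case_prod x' t) \<le> Y t"
    "\<And>U g. U \<subseteq> I \<times> J \<Longrightarrow> g \<in> basic \<Longrightarrow> (\<Sum>t\<in>U. case_prod x t) \<le> g \<Longrightarrow>
      \<exists>w\<in>basic. (\<Sum>t\<in>U. Y t) + w \<le> g \<and> g \<le> (\<Sum>t\<in>U. Y t) + scl (1 + e) w"
    by (rule multiplicative_cut[of "I \<times> J" "case_prod x" "case_prod x'" n e,
          OF finite_cartesian_product[OF I J] x_basic x_wb n e]) (assumption | rule that)+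
  define y where "y i j = Y (i, j)" for i j
  have y_basic: "y i j \<in> basic" if "i \<in> I" "j \<in> J" for i j
    unfolding y_def using that by (intro Y(1)) simp
  have ex: "\<exists>w. w \<in> basic \<and> (\<Sum>j\<in>J. y i j) + w \<le> f i \<and> f i \<le> (\<Sum>j\<in>J. y i j) + scl (1 + e) w"
    if "i \<in> I" for i
    using Y(3)[of "{i} \<times> J" "f i"] that f x(2) by (auto simp: sum_singleton_Times y_def)
  have "\<exists>w. \<forall>i\<in>I. w i \<in> basic \<and> (\<Sum>j\<in>J. y i j) + w i \<le> f i \<and>
      f i \<le> (\<Sum>j\<in>J. y i j) + scl (1 + e) (w i)"
    by (intro bchoice ballI) (rule ex)
  then obtain w where w: "\<forall>i\<in>I. w i \<in> basic \<and> (\<Sum>j\<in>J. y i j) + w i \<le> f i \<and>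
      f i \<le> (\<Sum>j\<in>J. y i j) + scl (1 + e) (w i)" ..
  have ex: "\<exists>z. z \<in> basic \<and> (\<Sum>i\<in>I. y i j) + z \<le> g j \<and> g j \<le> (\<Sum>i\<in>I. y i j) + scl (1 + e) z"
    if "j \<in> J" for j
    using Y(3)[of "I \<times> {j}" "g j"] that g x(3) by (auto simp: sum_Times_singleton y_def)
  have "\<exists>z. \<forall>j\<in>J. z j \<in> basic \<and> (\<Sum>i\<in>I. y i j) + z j \<le> g j \<and>
      g j \<le> (\<Sum>i\<in>I. y i j) + scl (1 + e) (z j)"
    by (intro bchoice ballI) (rule ex)
  then obtain z where z: "\<forall>j\<in>J. z j \<in> basic \<and> (\<Sum>i\<in>I. y i j) + z j \<le> g j \<and>
      g j \<le> (\<Sum>i\<in>I. y i j) + scl (1 + e) (z j)" ..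
  define G where "G j = scl (1 + e) (z j) + scl e (\<Sum>i\<in>I. y i j)" for j
  have G_basic: "G j \<in> basic" if "j \<in> J" for j
    unfolding G_def using that z y_basic eQ by (intro basic_add basic_scl basic_sum) auto
  have rest: "(\<Sum>i\<in>I. w i) \<le> (\<Sum>j\<in>J. G j)"
  proof (rule le_funI)
    fix \<phi>
    define A where "A = (\<Sum>i\<in>I. \<Sum>j\<in>J. y i j \<phi>)"
    have swap: "A = (\<Sum>j\<in>J. \<Sum>i\<in>I. y i j \<phi>)"
      unfolding A_def by (rule sum.swap)
    have "(\<Sum>i\<in>I. w i \<phi>) \<le> ennreal (1 + e) * (\<Sum>j\<in>J. z j \<phi>) + ennreal e * A"
    proof (rule ennreal_cancel_with_slack[OF _ _ _ e01(1)])
      have "(\<Sum>i\<in>I. (\<Sum>j\<in>J. y i j \<phi>) + w i \<phi>) \<le> (\<Sum>i\<in>I. f i \<phi>)"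
        using w by (intro sum_mono) (auto simp: le_fun_def sum_fun_apply)
      then show "A + (\<Sum>i\<in>I. w i \<phi>) \<le> (\<Sum>i\<in>I. f i \<phi>)"
        by (simp add: A_def sum.distrib)
      show "(\<Sum>i\<in>I. f i \<phi>) \<le> (\<Sum>j\<in>J. g j \<phi>)"
        using le by (simp add: le_fun_def sum_fun_apply)
      have "(\<Sum>j\<in>J. g j \<phi>) \<le> (\<Sum>j\<in>J. (\<Sum>i\<in>I. y i j \<phi>) + ennreal (1 + e) * z j \<phi>)"
        using z by (intro sum_mono) (auto simp: le_fun_def sum_fun_apply)
      then show "(\<Sum>j\<in>J. g j \<phi>) \<le> A + ennreal (1 + e) * (\<Sum>j\<in>J. z j \<phi>)"
        by (simp add: swap sum.distrib sum_distrib_left)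
    qed
    moreover have "(\<Sum>j\<in>J. G j \<phi>) = ennreal (1 + e) * (\<Sum>j\<in>J. z j \<phi>) + ennreal e * A"
      by (simp only: G_def plus_fun_apply scl_apply sum_fun_apply sum.distrib
          sum_distrib_left[symmetric] swap)
    ultimately show "(\<Sum>i\<in>I. w i) \<phi> \<le> (\<Sum>j\<in>J. G j) \<phi>"
      by (simp only: sum_fun_apply)
  qed
  \<comment> \<open>\<open>dec_D\<close> bounds its row sums below only in terms of some
    \<open>v\<close> with \<open>wb v w\<close>, so \<open>w\<close> is shrunk in advance while the
    estimate for \<open>f'\<close> is kept.\<close>
  have ex: "\<exists>v. v \<in> basic \<and> wb v (w i) \<and> f' i \<le> (\<Sum>j\<in>J. y i j) + scl (1 + e) v" if i: "i \<in> I" for i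
  proof -
    have *: "wb (f' i) ((\<Sum>j\<in>J. y i j) + scl (1 + e) (w i))"
      by (rule wb_mono[OF order_refl bspec[OF wb i] conjunct2[OF conjunct2[OF bspec[OF w i]]]])
    have y_sum: "(\<Sum>j\<in>J. y i j) \<in> basic"
      using i y_basic by (intro basic_sum) auto
    have e1: "1 + e \<in> \<rat>" "0 < 1 + e"
      using eQ e01 by auto
    obtain v where "v \<in> basic" "wb v (w i)" "f' i \<le> (\<Sum>j\<in>J. y i j) + scl (1 + e) v"
      by (rule wb_add_sclE[OF * y_sum conjunct1[OF bspec[OF w i]] e1]) (rule that)
    then show ?thesis
      by (intro exI[of _ v] conjI)
  qed
  have "\<exists>v. \<forall>i\<in>I. v i \<in> basic \<and> wb (v i) (w i) \<and> f' i \<le> (\<Sum>j\<in>J. y i j) + scl (1 + e) (v i)"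
    by (intro bchoice ballI) (rule ex)
  then obtain v where v: "\<forall>i\<in>I. v i \<in> basic \<and> wb (v i) (w i) \<and>
      f' i \<le> (\<Sum>j\<in>J. y i j) + scl (1 + e) (v i)" ..
  obtain k where k: "\<And>i j. i \<in> I \<Longrightarrow> j \<in> J \<Longrightarrow> k i j \<in> basic" "\<And>i. i \<in> I \<Longrightarrow> (\<Sum>j\<in>J. k i j) \<le> w i"
    "\<And>j. j \<in> J \<Longrightarrow> (\<Sum>i\<in>I. k i j) \<le> G j" "\<And>i. i \<in> I \<Longrightarrow> scl (1 / D) (v i) \<le> (\<Sum>j\<in>J. k i j)"
    by (rule decomposesE[OF dec_D _ G_basic rest, of v]) ((rule that; assumption) | (use w v in blast))+
  \<comment> \<open>\<open>k\<close> fits the enlarged columns \<open>G\<close>. With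
    \<open>y\<close> the column sum, \<open>y + G = (1 + e) * (y + z)\<close>, and the factor
    \<open>1 / (1 + e)\<close> brings this below \<open>g\<close>.\<close>
  define h where "h i j = scl (1 / (1 + e)) (y i j + k i j)" for i j
  have h_basic: "h i j \<in> basic" if "i \<in> I" "j \<in> J" for i j
    unfolding h_def using that y_basic k(1) eQ by (intro basic_scl basic_add) auto
  have rows: "(\<Sum>j\<in>J. h i j) \<le> f i" if i: "i \<in> I" for i
  proof (rule le_funI)
    fix \<phi>
    have "(\<Sum>j\<in>J. h i j) \<phi> = ennreal (1 / (1 + e)) * ((\<Sum>j\<in>J. y i j \<phi>) + (\<Sum>j\<in>J. k i j \<phi>))"
      by (simp add: h_def sum_scl_apply sum_fun_apply sum.distrib)
    also have "\<dots> \<le> 1 * ((\<Sum>j\<in>J. y i j \<phi>) + w i \<phi>)"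
      using k(2)[OF i] e01
      by (intro mult_mono add_left_mono) (auto simp: le_fun_def sum_fun_apply intro!: ennreal_le_1[THEN iffD2])
    also have "\<dots> \<le> f i \<phi>"
      using w i by (auto simp: le_fun_def sum_fun_apply)
    finally show "(\<Sum>j\<in>J. h i j) \<phi> \<le> f i \<phi>" .
  qed
  have cols: "(\<Sum>i\<in>I. h i j) \<le> g j" if j: "j \<in> J" for j
  proof (rule le_funI)
    fix \<phi>
    let ?y = "\<Sum>i\<in>I. y i j \<phi>"
    have one: "ennreal (1 / (1 + e)) * ennreal (1 + e) = 1"
      using e01 by (subst ennreal_mult'[symmetric]) auto
    have "(\<Sum>i\<in>I. h i j) \<phi> = ennreal (1 / (1 + e)) * (?y + (\<Sum>i\<in>I. k i j \<phi>))"
      by (simp add: h_def sum_scl_apply sum_fun_apply sum.distrib)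
    also have "\<dots> \<le> ennreal (1 / (1 + e)) * (?y + G j \<phi>)"
      using k(3)[OF j] by (intro mult_left_mono add_left_mono) (auto simp: le_fun_def sum_fun_apply)
    also have "?y + G j \<phi> = ennreal (1 + e) * (?y + z j \<phi>)"
      using e01 by (simp add: G_def sum_fun_apply distrib_left distrib_right ennreal_plus add_ac)
    also have "ennreal (1 / (1 + e)) * \<dots> = ?y + z j \<phi>"
      by (simp only: mult.assoc[symmetric] one mult_1)
    also have "\<dots> \<le> g j \<phi>"
      using z j by (auto simp: le_fun_def sum_fun_apply)
    finally show "(\<Sum>i\<in>I. h i j) \<phi> \<le> g j \<phi>" .
  qed
  have lower: "scl ?c' (f' i) \<le> (\<Sum>j\<in>J. h i j)" if i: "i \<in> I" for i
  proof (rule le_funI)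
    fix \<phi>
    have "ennreal ((1 - e)\<^sup>2 * c) * f' i \<phi> = ennreal ((1 - e)\<^sup>2) * scl c (f' i) \<phi>"
      using c by (simp add: ennreal_mult mult.assoc)
    also have "\<dots> \<le> ennreal ((1 - e)\<^sup>2) * (\<Sum>j\<in>J. x' i j \<phi>)"
      using x' i by (intro mult_left_mono) (auto simp: le_fun_def sum_fun_apply)
    also have "\<dots> \<le> (\<Sum>j\<in>J. y i j \<phi>)"
      unfolding sum_distrib_left
    proof (rule sum_mono)
      fix j assume "j \<in> J"
      then show "ennreal ((1 - e)\<^sup>2) * x' i j \<phi> \<le> y i j \<phi>"
        using Y(2)[of "(i, j)"] i by (simp add: le_fun_def y_def)
    qed
    finally have 1: "ennreal ((1 - e)\<^sup>2 * c) * f' i \<phi> \<le> (\<Sum>j\<in>J. y i j \<phi>)" .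
    have 2: "f' i \<phi> \<le> (\<Sum>j\<in>J. y i j \<phi>) + ennreal (1 + e) * v i \<phi>"
      using v i by (auto simp: le_fun_def sum_fun_apply)
    have 3: "ennreal (1 / D) * v i \<phi> \<le> (\<Sum>j\<in>J. k i j \<phi>)"
      using k(4)[OF i] by (auto simp: le_fun_def sum_fun_apply)
    have "0 \<le> (1 - e)\<^sup>2 * c"
      using c by simp
    from improved_lower_bound[OF e01(1) D this 1 2 3]
    show "scl ?c' (f' i) \<phi> \<le> (\<Sum>j\<in>J. h i j) \<phi>"
      by (simp add: h_def sum_scl_apply sum_fun_apply sum.distrib)
  qed
  show "\<exists>h. (\<forall>i\<in>I. \<forall>j\<in>J. h i j \<in> basic) \<and> (\<forall>i\<in>I. (\<Sum>j\<in>J. h i j) \<le> f i) \<and>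
          (\<forall>j\<in>J. (\<Sum>i\<in>I. h i j) \<le> g j) \<and> (\<forall>i\<in>I. scl ?c' (f' i) \<le> (\<Sum>j\<in>J. h i j))"
    using h_basic rows cols lower by (intro exI[of _ h]) simp
qed

text \<open>For \<open>e\<close> tending to 0 the improved constant tends to
  \<open>1 / D + (1 - 1 / D) * c\<close>, so every smaller \<open>d\<close> is attained.\<close>

lemma decomposes_improve_limit:
  assumes I: "finite I" and J: "finite J" and D: "1 \<le> D"
    and dec_D: "decomposes I J (1 / D) TYPE('a)" and dec_c: "decomposes I J c TYPE('a)"
    and c: "c \<in> \<rat>" "0 \<le> c" and d: "d < 1 / D + (1 - 1 / D) * c"
  shows "decomposes I J d TYPE('a)"
proof -
  define F where "F e = (((1 + e) * D - 1) * ((1 - e)\<^sup>2 * c) + 1) / ((1 + e) * D * (1 + e))" for e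
  have "(\<lambda>n. F (1 / real n)) \<longlonglongrightarrow> (((1 + 0) * D - 1) * ((1 - 0)\<^sup>2 * c) + 1) / ((1 + 0) * D * (1 + 0))"
    unfolding F_def using D by (intro tendsto_intros lim_1_over_n) auto
  moreover have "d < (((1 + 0) * D - 1) * ((1 - 0)\<^sup>2 * c) + 1) / ((1 + 0) * D * (1 + 0))"
    using d D by (simp add: field_simps)
  ultimately have "eventually (\<lambda>n. d < F (1 / real n)) sequentially"
    by (rule order_tendstoD(1))
  moreover have "eventually (\<lambda>n::nat. 1 < n) sequentially"
    by (rule eventually_gt_at_top)
  ultimately have "eventually (\<lambda>n. d < F (1 / real n) \<and> 1 < n) sequentially"
    by (rule eventually_conj)
  then obtain n where n: "d < F (1 / real n)" "1 < n"
    unfolding eventually_sequentially by blast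
  have "decomposes I J (F (1 / real n)) TYPE('a)"
    unfolding F_def by (rule decomposes_improve[OF I J D dec_D dec_c c n(2) refl])
  then show ?thesis
    using n(1) by (intro decomposes_mono[of I J "F (1 / real n)" d]) auto
qed

lemma decomposes_less_one:
  assumes I: "finite I" and J: "finite J" and d: "d < 1"
  shows "decomposes I J d TYPE('a)"
proof -
  define N where "N = Suc (card I + card J)"
  define D where "D = 2 * real N"
  have D: "2 \<le> D" by (simp add: D_def N_def)
  have dec_D: "decomposes I J (1 / D) TYPE('a)"
    unfolding D_def by (rule decomposes_initial) (auto simp: I J N_def)
  \<comment> \<open>\<open>1 - (1 - 1 / D) ^ l\<close> is the \<open>l\<close>-th iterate, started
    at 0, of the map from \<open>c\<close> to \<open>1 / D + (1 - 1 / D) * c\<close>.\<close>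
  have iter: "decomposes I J d TYPE('a)" if "d < 1 - (1 - 1 / D) ^ l" for l d
    using that
  proof (induction l arbitrary: d)
    case 0
    then show ?case
      by (intro decomposes_mono[OF decomposes_0]) simp
  next
    case (Suc l)
    define b where "b = 1 - (1 - 1 / D) ^ l"
    have d: "d < 1 / D + (1 - 1 / D) * b"
      using Suc.prems by (simp add: b_def algebra_simps)
    show ?case
    proof (cases "b \<le> 0")
      \<comment> \<open>This is \<open>l = 0\<close>: no positive rational lies below
        \<open>b\<close>, but \<open>d < 1 / D\<close>.\<close>
      case True
      then have "(1 - 1 / D) * b \<le> 0"
        using D by (intro mult_nonneg_nonpos) auto
      then have "d < 1 / D" using d by linarith
      then show ?thesis
        by (intro decomposes_mono[OF dec_D]) simp
    next
      case False
      have pos: "0 < 1 - 1 / D" using D by simp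
      then have "(d - 1 / D) / (1 - 1 / D) < b"
        using d by (simp add: pos_divide_less_eq mult.commute)
      \<comment> \<open>The next improvement wants a rational constant, the induction hypothesis one
        strictly below \<open>b\<close>. The lower limit comes from solving
        \<open>d < 1 / D + (1 - 1 / D) * q\<close> for \<open>q\<close>.\<close>
      with False obtain q where q: "q \<in> \<rat>" "max 0 ((d - 1 / D) / (1 - 1 / D)) < q" "q < b"
        using Rats_dense_in_real[of "max 0 ((d - 1 / D) / (1 - 1 / D))" b] by auto
      have "d < 1 / D + (1 - 1 / D) * q"
        using q(2) pos by (simp add: pos_divide_less_eq mult.commute)
      moreover have "decomposes I J q TYPE('a)"
        by (rule Suc.IH) (use q(3) in \<open>simp add: b_def\<close>)
      ultimately show ?thesis
        using decomposes_improve_limit[OF I J _ dec_D, of q d] q D by auto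
    qed
  qed
  have "(\<lambda>l. (1 - 1 / D) ^ l) \<longlonglongrightarrow> 0"
    using D by (intro LIMSEQ_power_zero) auto
  then have "eventually (\<lambda>l. (1 - 1 / D) ^ l < 1 - d) sequentially"
    using d by (intro order_tendstoD(2)) auto
  then obtain l where "(1 - 1 / D) ^ l < 1 - d"
    unfolding eventually_sequentially by blast
  then show ?thesis
    by (intro iter[of d l]) simp
qed

text \<open>The factor above 1 hidden in \<open>wb\<close> is why constants below 1 suffice: a
  decomposition that dominates \<open>scl c (q i)\<close> dominates \<open>p i\<close>.\<close>

lemma wb_le_scl:
  assumes "finite I" and "\<And>i. i \<in> I \<Longrightarrow> wb (p i) (q i :: 'a functional \<Rightarrow> ennreal)"
  obtains c where "c < 1" "\<And>i. i \<in> I \<Longrightarrow> p i \<le> scl c (q i)"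
proof -
  have "\<exists>c. c < 1 \<and> p i \<le> scl c (q i)" if i: "i \<in> I" for i
  proof -
    obtain c where c: "1 < c" "wb (scl c (p i)) (q i)"
      using wb_scl_expand[OF assms(2)[OF i]] by blast
    have "p i = scl (1 / c) (scl c (p i))"
      using c(1) by (simp add: scl_scl)
    also have "\<dots> \<le> scl (1 / c) (q i)"
      by (rule scl_mono[OF wb_imp_le[OF c(2)]])
    finally show ?thesis
      using c(1) by (intro exI[of _ "1 / c"]) auto
  qed
  then obtain c where c: "\<And>i. i \<in> I \<Longrightarrow> c i < 1 \<and> p i \<le> scl (c i) (q i)"
    by metis
  \<comment> \<open>0 is inserted so that the maximum exists for empty \<open>I\<close>.\<close>
  define m where "m = Max (insert 0 (c ` I))"
  have "m < 1"
    unfolding m_def using assms(1) c by (subst Max_less_iff) auto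
  moreover have "p i \<le> scl m (q i)" if "i \<in> I" for i
  proof -
    have "c i \<le> m"
      unfolding m_def using assms(1) that by (intro Max_ge) auto
    then show ?thesis
      using c[OF that] scl_mono_left order_trans by blast
  qed
  ultimately show thesis by (rule that)
qed

lemma S_R_refinement:
  fixes f f' :: "'i \<Rightarrow> 'a functional \<Rightarrow> ennreal" and g :: "'j \<Rightarrow> 'a functional \<Rightarrow> ennreal"
  assumes I: "finite I" and J: "finite J" and f: "\<And>i. i \<in> I \<Longrightarrow> f i \<in> S_R"
    and g: "\<And>j. j \<in> J \<Longrightarrow> g j \<in> S_R" and le: "(\<Sum>i\<in>I. f i) \<le> (\<Sum>j\<in>J. g j)"
    and wb: "\<And>i. i \<in> I \<Longrightarrow> wb (f' i) (f i)"
  obtains h where "\<And>i j. i \<in> I \<Longrightarrow> j \<in> J \<Longrightarrow> h i j \<in> basic"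
    "\<And>i. i \<in> I \<Longrightarrow> wb (f' i) (\<Sum>j\<in>J. h i j)" "\<And>i. i \<in> I \<Longrightarrow> wb (\<Sum>j\<in>J. h i j) (f i)"
    "\<And>j. j \<in> J \<Longrightarrow> (\<Sum>i\<in>I. h i j) \<le> g j"
proof -
  \<comment> \<open>Four gaps: \<open>r\<close> keeps the row sums strictly inside
    \<open>f i\<close>, the step from \<open>q\<close> to \<open>r\<close> feeds the decomposition,
    that from \<open>p\<close> to \<open>q\<close> absorbs the constant \<open>c < 1\<close>, and
    that from \<open>f' i\<close> to \<open>p\<close> makes the lower relation strict.\<close>
  have "\<exists>r q p. r \<in> basic \<and> wb r (f i) \<and> wb q r \<and> wb p q \<and> wb (f' i) p" if i: "i \<in> I" for i
  proof -
    obtain r where r: "r \<in> basic" "wb (f' i) r" "wb r (f i)"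
      using wb_interpolate[OF wb[OF i] f[OF i]] by blast
    obtain q where q: "q \<in> basic" "wb (f' i) q" "wb q r"
      using wb_interpolate[OF r(2) basic_in_S_R[OF r(1)]] by blast
    obtain p where "wb (f' i) p" "wb p q"
      using wb_interpolate[OF q(2) basic_in_S_R[OF q(1)]] by blast
    with r q show ?thesis by blast
  qed
  then obtain r q p where rqp: "\<And>i. i \<in> I \<Longrightarrow> r i \<in> basic" "\<And>i. i \<in> I \<Longrightarrow> wb (r i) (f i)"
    "\<And>i. i \<in> I \<Longrightarrow> wb (q i) (r i)" "\<And>i. i \<in> I \<Longrightarrow> wb (p i) (q i)" "\<And>i. i \<in> I \<Longrightarrow> wb (f' i) (p i)"
    by metis
  obtain c where c: "c < 1" "\<And>i. i \<in> I \<Longrightarrow> p i \<le> scl c (q i)"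
    by (rule wb_le_scl[OF I, of p q]) (use rqp(4) in auto)
  \<comment> \<open>The room between \<open>r\<close> and \<open>f\<close> also allows the
    \<open>g j\<close> to be replaced by functions in \<open>basic\<close> below them.\<close>
  have "wb (\<Sum>i\<in>I. r i) (\<Sum>j\<in>J. g j)"
    by (rule wb_mono[OF order_refl wb_sum le]) (rule rqp(2))
  then obtain z where z: "\<And>j. j \<in> J \<Longrightarrow> z j \<in> basic" "\<And>j. j \<in> J \<Longrightarrow> wb (z j) (g j)"
    "(\<Sum>i\<in>I. r i) \<le> (\<Sum>j\<in>J. z j)"
    by (rule wb_sumE[OF J g, rotated]) (assumption | rule that)+
  obtain h where h: "\<And>i j. i \<in> I \<Longrightarrow> j \<in> J \<Longrightarrow> h i j \<in> basic" "\<And>i. i \<in> I \<Longrightarrow> (\<Sum>j\<in>J. h i j) \<le> r i"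
    "\<And>j. j \<in> J \<Longrightarrow> (\<Sum>i\<in>I. h i j) \<le> z j" "\<And>i. i \<in> I \<Longrightarrow> scl c (q i) \<le> (\<Sum>j\<in>J. h i j)"
    by (rule decomposesE[OF decomposes_less_one[OF I J c(1)], of r z q]) ((rule that; assumption) | (use rqp z in simp))+
  show thesis
  proof (rule that[of h])
    fix i assume i: "i \<in> I"
    show "wb (f' i) (\<Sum>j\<in>J. h i j)"
      by (rule wb_mono[OF order_refl rqp(5)[OF i] order_trans[OF c(2)[OF i] h(4)[OF i]]])
    show "wb (\<Sum>j\<in>J. h i j) (f i)"
      by (rule wb_mono[OF h(2)[OF i] rqp(2)[OF i] order_refl])
  next
    fix j assume j: "j \<in> J"
    show "(\<Sum>i\<in>I. h i j) \<le> g j"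
      by (rule order_trans[OF h(3)[OF j] wb_imp_le[OF z(2)[OF j]]])
  qed (rule h(1))
qed

end

theorem theorem4p1p1:
  fixes f f' g :: "nat \<Rightarrow> ('a::ordered_semigroup functional \<Rightarrow> ennreal)"
    and n m :: nat
  assumes "axiom_O1 TYPE('a)" and "axiom_O2 TYPE('a)" and "axiom_O3 TYPE('a)"
    and "axiom_O4 TYPE('a)" and "axiom_O5 TYPE('a)" and "axiom_O6 TYPE('a)"
    and "\<And>i. i \<in> {1..n} \<Longrightarrow> f i \<in> S_R"
    and "\<And>j. j \<in> {1..m} \<Longrightarrow> g j \<in> S_R"
    and "(\<Sum>i\<in>{1..n}. f i) \<le> (\<Sum>j\<in>{1..m}. g j)"
    and "\<And>i. i \<in> {1..n} \<Longrightarrow> f' i \<in> S_R"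
    and "\<And>i. i \<in> {1..n} \<Longrightarrow> way_below S_R (f' i) (f i)"
  shows "\<exists>h :: nat \<Rightarrow> nat \<Rightarrow> ('a functional \<Rightarrow> ennreal).
           (\<forall>i\<in>{1..n}. \<forall>j\<in>{1..m}. h i j \<in> S_R) \<and>
           (\<forall>i\<in>{1..n}. way_below S_R (f' i) (\<Sum>j\<in>{1..m}. h i j) \<and>
                       way_below S_R (\<Sum>j\<in>{1..m}. h i j) (f i)) \<and>
           (\<forall>j\<in>{1..m}. (\<Sum>i\<in>{1..n}. h i j) \<le> g j)"
proof -
  interpret Cu_semigroup "TYPE('a)"
    by (rule Cu_semigroup.intro) (rule assms)+
  obtain h where h: "\<And>i j. i \<in> {1..n} \<Longrightarrow> j \<in> {1..m} \<Longrightarrow> h i j \<in> basic"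
    "\<And>i. i \<in> {1..n} \<Longrightarrow> wb (f' i) (\<Sum>j\<in>{1..m}. h i j)"
    "\<And>i. i \<in> {1..n} \<Longrightarrow> wb (\<Sum>j\<in>{1..m}. h i j) (f i)"
    "\<And>j. j \<in> {1..m} \<Longrightarrow> (\<Sum>i\<in>{1..n}. h i j) \<le> g j"
    by (rule S_R_refinement[of "{1..n}" "{1..m}" f g f'])
      (use assms(7-9,11) in \<open>auto simp: way_below_S_R_iff\<close>)
  have "(\<Sum>j\<in>{1..m}. h i j) \<in> S_R" if "i \<in> {1..n}" for i
    using h(1)[OF that] by (intro basic_in_S_R basic_sum)
  moreover have "h i j \<in> S_R" if "i \<in> {1..n}" "j \<in> {1..m}" for i j
    using h(1)[OF that] by (rule basic_in_S_R)
  ultimately show ?thesis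
    using h(2-4) assms(7,10) by (intro exI[of _ h]) (auto simp: way_below_S_R_iff)
qed

end
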